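(* Let $\mathcal{H}$ be a regular unitarily invariant complete Nevanlinna--Pick space on $\mathbb{B}_d$ which is not maximal. Let $\mathfrak{a}\subset \mathcal{M}(\mathcal{H})$ be a proper weak-$*$ closed ideal such that $\mathcal{H}_{\mathfrak{a}}$ has dimension greater than one. Then, the Gelfand transform of $\mathcal{A}_{\mathfrak{a}}$ is not completely isometric.
   Context: Let $d\ge 1$ and let $\mathbb{B}_d\subset\mathbb{C}^d$ be the open unit ball. A regular unitarily invariant complete Nevanlinna--Pick space on $\mathbb{B}_d$ is the reproducing kernel Hilbert space $\mathcal{H}$ of analytic functions on $\mathbb{B}_d$ with a kernel of the form $k(z,w)=\sum_{n=0}^\infty a_n\langle z,w\rangle^n$, where $a_0=1$, $a_n>0$ for all $n$, $\lim_{n\to\infty} a_n/a_{n+1}=1$, and such that $1-\frac{1}{k(z,w)}=\sum_{n=1}^\infty b_n\langle z,w\rangle^n$ on $\mathbb{B}_d\times\mathbb{B}_d$ with all $b_n\ge 0$ (then automatically $\sum_n b_n\le 1$). It is called maximal if $\sum_{n=1}^\infty b_n=1$. $\mathcal{M}(\mathcal{H})$ is the algebra of multipliers of $\mathcal{H}$ (functions $\psi:\mathbb{B}_d\to\mathbb{C}$ with $\psi\mathcal{H}\subset\mathcal{H}$), identified with the algebra of multiplication operators $M_\psi$; it is a weak-$*$ closed subalgebra of $B(\mathcal{H})$ and contains the polynomials. $\mathcal{A}(\mathcal{H})$ is the norm closure of the polynomials in $\mathcal{M}(\mathcal{H})$. For a weak-$*$ closed ideal $\mathfrak{a}\subset\mathcal{M}(\mathcal{H})$,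 put $[\mathfrak{a}\mathcal{H}]=\overline{\mathrm{span}}\{M_\phi f:\phi\in\mathfrak{a},f\in\mathcal{H}\}$, $\mathcal{H}_{\mathfrak{a}}=\mathcal{H}\ominus[\mathfrak{a}\mathcal{H}]$, $\psi(Z_{\mathfrak{a}})=P_{\mathcal{H}_{\mathfrak{a}}}M_\psi|_{\mathcal{H}_{\mathfrak{a}}}$ for $\psi\in\mathcal{M}(\mathcal{H})$. Then $\mathcal{A}_{\mathfrak{a}}\subset B(\mathcal{H}_{\mathfrak{a}})$ is the norm closure of $\{\phi(Z_{\mathfrak{a}}):\phi\in\mathcal{A}(\mathcal{H})\}$, a commutative unital operator algebra. For a commutative unital Banach algebra $\mathfrak{B}$, $\Delta(\mathfrak{B})$ is its space of characters and the Gelfand transform is $g:\mathfrak{B}\to C(\Delta(\mathfrak{B}))$, $g(b)(\chi)=\chi(b)$. For an operator algebra $\mathfrak{B}$, it is completely isometric if $\|[b_{ij}]\|_{\mathbb{M}_n(\mathfrak{B})}=\max_{\chi\in\Delta(\mathfrak{B})}\|[\chi(b_{ij})]\|_{\mathbb{M}_n}$ for all $n\ge1$ and $[b_{ij}]\in\mathbb{M}_n(\mathfrak{B})$. *)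

theory Defs
  imports "HOL-Analysis.Analysis" "HOL-Library.Function_Algebras"
begin

section \<open>Hilbert spaces of complex-valued functions\<close>

text \<open>
  The library has no complex Hilbert spaces.  All Hilbert spaces below are linear subspaces
  \<open>H\<close> of the space of functions \<open>'a \<Rightarrow> complex\<close> (with the pointwise operations of
  \<open>Function_Algebras\<close>), carrying an inner product \<open>ip\<close> that is only meaningful on \<open>H\<close>.
  A function on a set \<open>X \<subseteq> 'a\<close> is represented by its extension by \<open>0\<close>.
\<close>

type_synonym 'a cfun = "'a \<Rightarrow> complex"

definition cscale :: "complex \<Rightarrow> 'a cfun \<Rightarrow> 'a cfun" where
  "cscale c f = (\<lambda>x. c * f x)"

interpretation cfun: vector_space "cscale :: complex \<Rightarrow> 'a cfun \<Rightarrow> 'a cfun"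
  by unfold_locales (auto simp: cscale_def fun_eq_iff algebra_simps)

definition ipnorm :: "('a cfun \<Rightarrow> 'a cfun \<Rightarrow> complex) \<Rightarrow> 'a cfun \<Rightarrow> real" where
  "ipnorm ip f = sqrt (Re (ip f f))"

definition inner_product_on :: "'a cfun set \<Rightarrow> ('a cfun \<Rightarrow> 'a cfun \<Rightarrow> complex) \<Rightarrow> bool" where
  "inner_product_on H ip \<longleftrightarrow>
     (\<forall>f\<in>H. \<forall>g\<in>H. \<forall>h\<in>H. ip (f + g) h = ip f h + ip g h) \<and>
     (\<forall>c. \<forall>f\<in>H. \<forall>g\<in>H. ip (cscale c f) g = c * ip f g) \<and>
     (\<forall>f\<in>H. \<forall>g\<in>H. ip g f = cnj (ip f g)) \<and>
     (\<forall>f\<in>H. 0 \<le> Re (ip f f)) \<and>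
     (\<forall>f\<in>H. ip f f = 0 \<longrightarrow> f = 0)"

definition hilbert_space_on :: "'a cfun set \<Rightarrow> ('a cfun \<Rightarrow> 'a cfun \<Rightarrow> complex) \<Rightarrow> bool" where
  "hilbert_space_on H ip \<longleftrightarrow>
     cfun.subspace H \<and> inner_product_on H ip \<and>
     (\<forall>s :: nat \<Rightarrow> 'a cfun. range s \<subseteq> H \<longrightarrow>
        (\<forall>e>0. \<exists>N. \<forall>m\<ge>N. \<forall>n\<ge>N. ipnorm ip (s m - s n) < e) \<longrightarrow>
        (\<exists>f\<in>H. (\<lambda>n. ipnorm ip (s n - f)) \<longlonglongrightarrow> 0))"

definition norm_closure_on ::
  "'a cfun set \<Rightarrow> ('a cfun \<Rightarrow> 'a cfun \<Rightarrow> complex) \<Rightarrow> 'a cfun set \<Rightarrow> 'a cfun set" where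
  "norm_closure_on H ip S = {f\<in>H. \<forall>e>0. \<exists>g\<in>S. ipnorm ip (f - g) < e}"

definition orth_compl ::
  "'a cfun set \<Rightarrow> ('a cfun \<Rightarrow> 'a cfun \<Rightarrow> complex) \<Rightarrow> 'a cfun set \<Rightarrow> 'a cfun set" where
  "orth_compl H ip S = {f\<in>H. \<forall>g\<in>S. ip f g = 0}"

definition orth_proj ::
  "'a cfun set \<Rightarrow> ('a cfun \<Rightarrow> 'a cfun \<Rightarrow> complex) \<Rightarrow> 'a cfun \<Rightarrow> 'a cfun" where
  "orth_proj K ip f = (THE g. g \<in> K \<and> (\<forall>h\<in>K. ip (f - g) h = 0))"

definition rkhs_on ::
  "'a set \<Rightarrow> ('a \<Rightarrow> 'a \<Rightarrow> complex) \<Rightarrow> 'a cfun set \<Rightarrow> ('a cfun \<Rightarrow> 'a cfun \<Rightarrow> complex) \<Rightarrow> bool"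
where
  "rkhs_on X k H ip \<longleftrightarrow>
     hilbert_space_on H ip \<and>
     (\<forall>f\<in>H. \<forall>z. z \<notin> X \<longrightarrow> f z = 0) \<and>
     (\<forall>w\<in>X. (\<lambda>z. if z \<in> X then k z w else 0) \<in> H \<and>
        (\<forall>f\<in>H. f w = ip f (\<lambda>z. if z \<in> X then k z w else 0)))"


section \<open>Bounded operators and operator algebras\<close>

text \<open>
  An operator on \<open>K\<close> is represented by the total function that is \<open>0\<close> outside \<open>K\<close>.  Hence sums,
  scalar multiples and compositions of operators are the pointwise sums, pointwise scalar
  multiples and compositions of the representing functions, and equality is equality of
  functions.
\<close>

type_synonym 'a cop = "'a cfun \<Rightarrow> 'a cfun"

definition bounded_ops ::
  "'a cfun set \<Rightarrow> ('a cfun \<Rightarrow> 'a cfun \<Rightarrow> complex) \<Rightarrow> 'a cop set" where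
  "bounded_ops K ip =
     {T. (\<forall>f\<in>K. T f \<in> K) \<and>
         (\<forall>f\<in>K. \<forall>g\<in>K. T (f + g) = T f + T g) \<and>
         (\<forall>c. \<forall>f\<in>K. T (cscale c f) = cscale c (T f)) \<and>
         (\<exists>C. \<forall>f\<in>K. ipnorm ip (T f) \<le> C * ipnorm ip f) \<and>
         (\<forall>f. f \<notin> K \<longrightarrow> T f = 0)}"

definition op_norm ::
  "'a cfun set \<Rightarrow> ('a cfun \<Rightarrow> 'a cfun \<Rightarrow> complex) \<Rightarrow> 'a cop \<Rightarrow> real" where
  "op_norm K ip T = (SUP f \<in> {f\<in>K. ipnorm ip f \<le> 1}. ipnorm ip (T f))"

text \<open>
  The norm of \<open>\<bbbM>\<^sub>n(B(K)) = B(K\<^sup>n)\<close>: the operator norm of an \<open>n \<times> n\<close> matrix of operators (entries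
  with indices below \<open>n\<close>) acting on the \<open>n\<close>-fold Hilbert space direct sum of \<open>K\<close>.
\<close>

definition op_matrix_norm ::
  "'a cfun set \<Rightarrow> ('a cfun \<Rightarrow> 'a cfun \<Rightarrow> complex) \<Rightarrow> nat \<Rightarrow> (nat \<Rightarrow> nat \<Rightarrow> 'a cop) \<Rightarrow> real" where
  "op_matrix_norm K ip n B =
     (SUP v \<in> {v. (\<forall>j<n. v j \<in> K) \<and> (\<Sum>j<n. (ipnorm ip (v j))\<^sup>2) \<le> 1}.
        sqrt (\<Sum>i<n. (ipnorm ip (\<Sum>j<n. B i j (v j)))\<^sup>2))"

definition scalar_matrix_norm :: "nat \<Rightarrow> (nat \<Rightarrow> nat \<Rightarrow> complex) \<Rightarrow> real" where
  "scalar_matrix_norm n A =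
     (SUP v \<in> {v. (\<Sum>j<n. (cmod (v j))\<^sup>2) \<le> 1}.
        sqrt (\<Sum>i<n. (cmod (\<Sum>j<n. A i j * v j))\<^sup>2))"

text \<open>
  The weak-* topology of \<open>B(K)\<close> as the dual of the trace class operators; the normal functionals
  are the maps \<open>T \<mapsto> (\<Sum>n. \<langle>T s\<^sub>n, t\<^sub>n\<rangle>)\<close> for square summable sequences \<open>s\<close> and \<open>t\<close>
  in \<open>K\<close>.
\<close>

definition square_summable_seqs ::
  "'a cfun set \<Rightarrow> ('a cfun \<Rightarrow> 'a cfun \<Rightarrow> complex) \<Rightarrow> (nat \<Rightarrow> 'a cfun) set" where
  "square_summable_seqs K ip = {s. range s \<subseteq> K \<and> summable (\<lambda>n. (ipnorm ip (s n))\<^sup>2)}"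

definition weak_star_topology ::
  "'a cfun set \<Rightarrow> ('a cfun \<Rightarrow> 'a cfun \<Rightarrow> complex) \<Rightarrow> 'a cop topology" where
  "weak_star_topology K ip = topology_generated_by
     {{T \<in> bounded_ops K ip. (\<Sum>n. ip (T (s n)) (t n)) \<in> U} | s t U.
        s \<in> square_summable_seqs K ip \<and> t \<in> square_summable_seqs K ip \<and> open U}"

text \<open>Characters of an algebra \<open>\<BB>\<close> of operators; they are normalised to be \<open>0\<close> outside \<open>\<BB>\<close>.\<close>

definition characters :: "'a cop set \<Rightarrow> ('a cop \<Rightarrow> complex) set" where
  "characters \<BB> =
     {\<tau>. (\<forall>S\<in>\<BB>. \<forall>T\<in>\<BB>. \<tau> (S + T) = \<tau> S + \<tau> T) \<and>
         (\<forall>c. \<forall>T\<in>\<BB>. \<tau> (\<lambda>f. cscale c (T f)) = c * \<tau> T) \<and>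
         (\<forall>S\<in>\<BB>. \<forall>T\<in>\<BB>. \<tau> (S \<circ> T) = \<tau> S * \<tau> T) \<and>
         (\<exists>T\<in>\<BB>. \<tau> T \<noteq> 0) \<and>
         (\<forall>T. T \<notin> \<BB> \<longrightarrow> \<tau> T = 0)}"

definition gelfand_transform :: "'a cop set \<Rightarrow> 'a cop \<Rightarrow> ('a cop \<Rightarrow> complex) \<Rightarrow> complex" where
  "gelfand_transform \<BB> T = (\<lambda>\<tau>\<in>characters \<BB>. \<tau> T)"

text \<open>
  The two conjuncts below say that the norm of \<open>[b\<^sub>i\<^sub>j]\<close> is the maximum over all characters \<open>\<tau>\<close> of
  the norm of \<open>[\<tau>(b\<^sub>i\<^sub>j)]\<close>.
\<close>

definition gelfand_completely_isometric ::
  "'a cfun set \<Rightarrow> ('a cfun \<Rightarrow> 'a cfun \<Rightarrow> complex) \<Rightarrow> 'a cop set \<Rightarrow> bool" where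
  "gelfand_completely_isometric K ip \<BB> \<longleftrightarrow>
     (\<forall>n\<ge>1. \<forall>B. (\<forall>i<n. \<forall>j<n. B i j \<in> \<BB>) \<longrightarrow>
        (\<exists>\<tau>\<in>characters \<BB>. op_matrix_norm K ip n B =
            scalar_matrix_norm n (\<lambda>i j. gelfand_transform \<BB> (B i j) \<tau>)) \<and>
        (\<forall>\<tau>\<in>characters \<BB>. scalar_matrix_norm n (\<lambda>i j. gelfand_transform \<BB> (B i j) \<tau>)
            \<le> op_matrix_norm K ip n B))"


section \<open>Multipliers\<close>

definition multipliers :: "'a set \<Rightarrow> 'a cfun set \<Rightarrow> 'a cfun set" where
  "multipliers X H = {\<psi>. (\<forall>z. z \<notin> X \<longrightarrow> \<psi> z = 0) \<and> (\<forall>f\<in>H. \<psi> * f \<in> H)}"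

definition mult_op :: "'a cfun set \<Rightarrow> 'a cfun \<Rightarrow> 'a cop" where
  "mult_op H \<psi> = (\<lambda>f. if f \<in> H then \<psi> * f else 0)"

definition weak_star_closed_ideal ::
  "'a set \<Rightarrow> 'a cfun set \<Rightarrow> ('a cfun \<Rightarrow> 'a cfun \<Rightarrow> complex) \<Rightarrow> 'a cfun set \<Rightarrow> bool" where
  "weak_star_closed_ideal X H ip \<aa> \<longleftrightarrow>
     \<aa> \<subseteq> multipliers X H \<and> cfun.subspace \<aa> \<and>
     (\<forall>\<psi>\<in>multipliers X H. \<forall>\<phi>\<in>\<aa>. \<psi> * \<phi> \<in> \<aa>) \<and>
     closedin (weak_star_topology H ip) (mult_op H ` \<aa>)"

text \<open>The spaces \<open>[\<aa>H]\<close> and \<open>H\<^sub>\<aa> = H \<ominus> [\<aa>H]\<close>, and the operators \<open>\<psi>(Z\<^sub>\<aa>)\<close>.\<close>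

definition ideal_space ::
  "'a cfun set \<Rightarrow> ('a cfun \<Rightarrow> 'a cfun \<Rightarrow> complex) \<Rightarrow> 'a cfun set \<Rightarrow> 'a cfun set" where
  "ideal_space H ip \<aa> = norm_closure_on H ip (cfun.span {mult_op H \<phi> f | \<phi> f. \<phi> \<in> \<aa> \<and> f \<in> H})"

definition quotient_space ::
  "'a cfun set \<Rightarrow> ('a cfun \<Rightarrow> 'a cfun \<Rightarrow> complex) \<Rightarrow> 'a cfun set \<Rightarrow> 'a cfun set" where
  "quotient_space H ip \<aa> = orth_compl H ip (ideal_space H ip \<aa>)"

definition compressed_mult ::
  "'a cfun set \<Rightarrow> ('a cfun \<Rightarrow> 'a cfun \<Rightarrow> complex) \<Rightarrow> 'a cfun set \<Rightarrow> 'a cfun \<Rightarrow> 'a cop" where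
  "compressed_mult H ip \<aa> \<psi> =
     (\<lambda>f. if f \<in> quotient_space H ip \<aa>
          then orth_proj (quotient_space H ip \<aa>) ip (mult_op H \<psi> f) else 0)"


section \<open>Unitarily invariant spaces on the unit ball\<close>

definition cinner :: "complex ^ 'd \<Rightarrow> complex ^ 'd \<Rightarrow> complex" where
  "cinner z w = (\<Sum>i\<in>UNIV. z $ i * cnj (w $ i))"

definition ui_kernel :: "(nat \<Rightarrow> real) \<Rightarrow> complex ^ 'd \<Rightarrow> complex ^ 'd \<Rightarrow> complex" where
  "ui_kernel a z w = (\<Sum>n. complex_of_real (a n) * cinner z w ^ n)"

definition analytic_on_ball :: "(complex ^ 'd) cfun \<Rightarrow> bool" where
  "analytic_on_ball f \<longleftrightarrow>
     (\<forall>z\<in>ball 0 1. \<exists>D. (f has_derivative D) (at z) \<and> (\<forall>c v. D (c *s v) = c * D v))"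

text \<open>
  \<open>H\<close> (with inner product \<open>ip\<close>) is the regular unitarily invariant complete Nevanlinna--Pick space
  on the ball with coefficients \<open>a\<close> of the kernel \<open>k\<close> and coefficients \<open>b\<close> of \<open>1 - 1/k\<close>; the value
  \<open>b 0\<close> is never used.
\<close>

definition regular_ui_cnp_space ::
  "(complex ^ 'd) cfun set \<Rightarrow> ((complex ^ 'd) cfun \<Rightarrow> (complex ^ 'd) cfun \<Rightarrow> complex) \<Rightarrow>
   (nat \<Rightarrow> real) \<Rightarrow> (nat \<Rightarrow> real) \<Rightarrow> bool" where
  "regular_ui_cnp_space H ip a b \<longleftrightarrow>
     a 0 = 1 \<and> (\<forall>n. a n > 0) \<and> (\<lambda>n. a n / a (Suc n)) \<longlonglongrightarrow> 1 \<and>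
     (\<forall>n\<ge>1. b n \<ge> 0) \<and>
     (\<forall>z\<in>ball (0 :: complex ^ 'd) 1. \<forall>w\<in>ball 0 1. ui_kernel a z w \<noteq> 0 \<and>
        (\<lambda>n. complex_of_real (b (Suc n)) * cinner z w ^ Suc n) sums (1 - 1 / ui_kernel a z w)) \<and>
     rkhs_on (ball 0 1) (ui_kernel a) H ip \<and>
     (\<forall>f\<in>H. analytic_on_ball f)"

definition maximal_cnp :: "(nat \<Rightarrow> real) \<Rightarrow> bool" where
  "maximal_cnp b \<longleftrightarrow> (\<lambda>n. b (Suc n)) sums 1"

definition ball_polynomials :: "(complex ^ 'd) cfun set" where
  "ball_polynomials =
     cfun.span (range (\<lambda>\<alpha> :: 'd \<Rightarrow> nat. \<lambda>z. if z \<in> ball 0 1 then \<Prod>i\<in>UNIV. z $ i ^ \<alpha> i else 0))"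

text \<open>The norm closure of the polynomials in the multiplier algebra, and the algebra \<open>\<A>\<^sub>\<aa>\<close>.\<close>

definition poly_mult_closure ::
  "(complex ^ 'd) cfun set \<Rightarrow> ((complex ^ 'd) cfun \<Rightarrow> (complex ^ 'd) cfun \<Rightarrow> complex) \<Rightarrow>
   (complex ^ 'd) cfun set" where
  "poly_mult_closure H ip =
     {\<psi> \<in> multipliers (ball 0 1) H. \<forall>e>0. \<exists>p\<in>ball_polynomials.
        op_norm H ip (mult_op H \<psi> - mult_op H p) < e}"

definition quotient_algebra ::
  "(complex ^ 'd) cfun set \<Rightarrow> ((complex ^ 'd) cfun \<Rightarrow> (complex ^ 'd) cfun \<Rightarrow> complex) \<Rightarrow>
   (complex ^ 'd) cfun set \<Rightarrow> (complex ^ 'd) cop set" where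
  "quotient_algebra H ip \<aa> =
     {T \<in> bounded_ops (quotient_space H ip \<aa>) ip. \<forall>e>0. \<exists>\<phi>\<in>poly_mult_closure H ip.
        op_norm (quotient_space H ip \<aa>) ip (T - compressed_mult H ip \<aa> \<phi>) < e}"

end

theory Submission
  imports Defs
begin

text \<open>
  The coefficients of \<open>1 - 1/k\<close> turn the monomials into a row operator
  \<open>R = (sqrt b\<^sub>n z\<^sup>p)\<close>, one entry for each nonempty word \<open>p\<close> of length \<open>n\<close>, with
  \<open>R R* = I - 1 \<otimes> 1\<close> on \<open>H\<close>.  Since \<open>H\<^sub>\<aa>\<close> is co-invariant, the finite truncations of
  the compressed row are contractions, and a unit vector of \<open>H\<^sub>\<aa>\<close> that vanishes at the origin
  (it exists as soon as the dimension exceeds one) shows that their norms tend to \<open>1\<close>.  A character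
  maps the coordinates to a point \<open>\<lambda>\<close>, and hence the truncated row to a scalar row of norm
  \<open>(\<Sum> b\<^sub>n |\<lambda>|\<^sup>2\<^sup>n)\<^sup>1\<^sup>/\<^sup>2\<close>.  If the Gelfand transform is completely isometric, these scalar rows are
  contractions, which forces \<open>|\<lambda>| \<le> 1\<close>: otherwise the recursion \<open>a\<^sub>n = \<Sum> b\<^sub>j a\<^sub>n\<^sub>-\<^sub>j\<close> would
  make the radius of convergence of \<open>\<Sum> a\<^sub>n x\<^sup>n\<close> larger than \<open>1\<close>.  So the norms of the truncated
  rows stay below \<open>(\<Sum> b\<^sub>n)\<^sup>1\<^sup>/\<^sup>2 < 1\<close>, a contradiction.
\<close>

subsection \<open>Hilbert spaces of functions\<close>

locale hilb =
  fixes H :: "'a cfun set" and ip :: "'a cfun \<Rightarrow> 'a cfun \<Rightarrow> complex"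
  assumes hilbert: "hilbert_space_on H ip"
begin

abbreviation nrm where "nrm \<equiv> ipnorm ip"

lemma subspace: "cfun.subspace H"
  using hilbert by (simp add: hilbert_space_on_def)

lemma inner: "inner_product_on H ip"
  using hilbert by (simp add: hilbert_space_on_def)

lemmas zero_mem [simp] = cfun.subspace_0[OF subspace]
lemmas add_mem [simp] = cfun.subspace_add[OF subspace]
lemmas diff_mem [simp] = cfun.subspace_diff[OF subspace]
lemmas scale_mem [simp] = cfun.subspace_scale[OF subspace]
lemmas sum_mem = cfun.subspace_sum[OF subspace]

lemma add_left [simp]: "f \<in> H \<Longrightarrow> g \<in> H \<Longrightarrow> h \<in> H \<Longrightarrow> ip (f + g) h = ip f h + ip g h"
  and scale_left [simp]: "f \<in> H \<Longrightarrow> g \<in> H \<Longrightarrow> ip (cscale c f) g = c * ip f g"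
  and ip_cnj: "f \<in> H \<Longrightarrow> g \<in> H \<Longrightarrow> ip g f = cnj (ip f g)"
  and ip_nonneg: "f \<in> H \<Longrightarrow> 0 \<le> Re (ip f f)"
  and ip_zeroD: "f \<in> H \<Longrightarrow> ip f f = 0 \<Longrightarrow> f = 0"
proof -
  note I = inner[unfolded inner_product_on_def]
  show "f \<in> H \<Longrightarrow> g \<in> H \<Longrightarrow> h \<in> H \<Longrightarrow> ip (f + g) h = ip f h + ip g h"
    using conjunct1[OF I] by blast
  show "f \<in> H \<Longrightarrow> g \<in> H \<Longrightarrow> ip (cscale c f) g = c * ip f g"
    using conjunct1[OF conjunct2[OF I]] by blast
  show "f \<in> H \<Longrightarrow> g \<in> H \<Longrightarrow> ip g f = cnj (ip f g)"
    using conjunct1[OF conjunct2[OF conjunct2[OF I]]] by blast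
  show "f \<in> H \<Longrightarrow> 0 \<le> Re (ip f f)"
    using conjunct1[OF conjunct2[OF conjunct2[OF conjunct2[OF I]]]] by blast
  show "f \<in> H \<Longrightarrow> ip f f = 0 \<Longrightarrow> f = 0"
    using conjunct2[OF conjunct2[OF conjunct2[OF conjunct2[OF I]]]] by blast
qed

lemma add_right [simp]: "f \<in> H \<Longrightarrow> g \<in> H \<Longrightarrow> h \<in> H \<Longrightarrow> ip h (f + g) = ip h f + ip h g"
  by (simp add: ip_cnj[of _ h])

lemma scale_right [simp]: "f \<in> H \<Longrightarrow> g \<in> H \<Longrightarrow> ip g (cscale c f) = cnj c * ip g f"
  by (simp add: ip_cnj[of _ g])

lemma zero_left [simp]: "f \<in> H \<Longrightarrow> ip 0 f = 0"
  using add_left[of 0 0 f] by (simp del: add_left)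

lemma zero_right [simp]: "f \<in> H \<Longrightarrow> ip f 0 = 0"
  using add_right[of 0 0 f] by (simp del: add_right)

lemma diff_left [simp]: "f \<in> H \<Longrightarrow> g \<in> H \<Longrightarrow> h \<in> H \<Longrightarrow> ip (f - g) h = ip f h - ip g h"
  using add_left[of "f - g" g h] by (simp del: add_left)

lemma diff_right [simp]: "f \<in> H \<Longrightarrow> g \<in> H \<Longrightarrow> h \<in> H \<Longrightarrow> ip h (f - g) = ip h f - ip h g"
  using add_right[of "f - g" g h] by (simp del: add_right)

lemma sum_left: "(\<And>i. i \<in> I \<Longrightarrow> f i \<in> H) \<Longrightarrow> h \<in> H \<Longrightarrow> ip (\<Sum>i\<in>I. f i) h = (\<Sum>i\<in>I. ip (f i) h)"
  by (induction I rule: infinite_finite_induct) (auto simp: sum_mem)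

lemma ip_self: "f \<in> H \<Longrightarrow> ip f f = complex_of_real ((nrm f)\<^sup>2)"
  using ip_nonneg[of f] ip_cnj[of f f] by (auto simp: ipnorm_def complex_eq_iff)

lemma nrm_sq: "f \<in> H \<Longrightarrow> (nrm f)\<^sup>2 = Re (ip f f)"
  by (simp add: ip_self)

lemma nrm_nonneg [simp]: "f \<in> H \<Longrightarrow> 0 \<le> nrm f"
  using ip_nonneg[of f] by (simp add: ipnorm_def)

lemma nrm_0 [simp]: "nrm 0 = 0"
  by (simp add: ipnorm_def)

lemma nrm_eq_0: "f \<in> H \<Longrightarrow> nrm f = 0 \<Longrightarrow> f = 0"
  using ip_self[of f] ip_zeroD[of f] by simp

lemma nrm_scale [simp]: "f \<in> H \<Longrightarrow> nrm (cscale c f) = cmod c * nrm f"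
proof -
  assume f: "f \<in> H"
  have "ip (cscale c f) (cscale c f) = complex_of_real ((cmod c)\<^sup>2) * ip f f"
    using f by (simp only: scale_left scale_right scale_mem complex_norm_square mult_ac)
  then have "(nrm (cscale c f))\<^sup>2 = (cmod c * nrm f)\<^sup>2"
    using f nrm_sq[of f] nrm_sq[of "cscale c f"]
    by (simp add: power_mult_distrib del: scale_left scale_right of_real_power)
  then show ?thesis using f by (simp add: power2_eq_iff_nonneg)
qed

lemma nrm_minus_commute: "f \<in> H \<Longrightarrow> g \<in> H \<Longrightarrow> nrm (f - g) = nrm (g - f)"
proof -
  assume fg: "f \<in> H" "g \<in> H"
  have "cscale (-1) (f - g) = g - f" by (auto simp: cscale_def fun_eq_iff)
  then show ?thesis using nrm_scale[of "f - g" "-1"] fg by simp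
qed

lemma nrm_add_sq:
  assumes "f \<in> H" "g \<in> H"
  shows "(nrm (f + g))\<^sup>2 = (nrm f)\<^sup>2 + 2 * Re (ip f g) + (nrm g)\<^sup>2"
  using assms by (simp add: nrm_sq ip_cnj[of f g])

lemma nrm_diff_sq:
  assumes "f \<in> H" "g \<in> H"
  shows "(nrm (f - g))\<^sup>2 = (nrm f)\<^sup>2 - 2 * Re (ip f g) + (nrm g)\<^sup>2"
  using assms by (simp add: nrm_sq ip_cnj[of f g])

lemma cauchy_schwarz:
  assumes f: "f \<in> H" and g: "g \<in> H"
  shows "cmod (ip f g) \<le> nrm f * nrm g"
proof (cases "nrm g = 0")
  case True
  then show ?thesis using nrm_eq_0[OF g] f by simp
next
  case False
  define c where "c = ip f g / complex_of_real ((nrm g)\<^sup>2)"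
  have "0 \<le> (nrm (f - cscale c g))\<^sup>2" by simp
  also have "\<dots> = (nrm f)\<^sup>2 - 2 * Re (cnj c * ip f g) + (cmod c)\<^sup>2 * (nrm g)\<^sup>2"
    using f g by (subst nrm_diff_sq) (auto simp: power_mult_distrib)
  also have "cnj c * ip f g = complex_of_real ((cmod (ip f g))\<^sup>2 / (nrm g)\<^sup>2)"
    by (simp only: complex_norm_square of_real_divide) (simp add: c_def)
  also have "(cmod c)\<^sup>2 * (nrm g)\<^sup>2 = (cmod (ip f g))\<^sup>2 / (nrm g)\<^sup>2"
    using False by (simp add: c_def norm_divide norm_power norm_mult power_divide power2_eq_square)
  finally have "(cmod (ip f g))\<^sup>2 \<le> (nrm f * nrm g)\<^sup>2"
    using False by (simp add: field_simps power_mult_distrib)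
  then show ?thesis using f g by (simp add: power2_le_iff_abs_le)
qed

lemma triangle:
  assumes "f \<in> H" "g \<in> H"
  shows "nrm (f + g) \<le> nrm f + nrm g"
proof -
  have "(nrm (f + g))\<^sup>2 \<le> (nrm f + nrm g)\<^sup>2"
    using nrm_add_sq[OF assms] cauchy_schwarz[OF assms] complex_Re_le_cmod[of "ip f g"]
    by (simp add: power2_sum)
  then show ?thesis using assms by (simp add: power2_le_iff_abs_le)
qed

lemma triangle_diff:
  assumes "f \<in> H" "g \<in> H"
  shows "nrm f \<le> nrm g + nrm (f - g)"
  using triangle[of g "f - g"] assms by simp

lemma tendsto_ip:
  assumes s: "range s \<subseteq> H" and g: "g \<in> H" and lim: "(\<lambda>n. nrm (s n - g)) \<longlonglongrightarrow> 0" and h: "h \<in> H"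
  shows "(\<lambda>n. ip h (s n)) \<longlonglongrightarrow> ip h g"
proof -
  have "\<forall>n. cmod (ip h (s n) - ip h g) \<le> nrm h * nrm (s n - g)"
  proof
    fix n
    show "cmod (ip h (s n) - ip h g) \<le> nrm h * nrm (s n - g)"
      using cauchy_schwarz[of h "s n - g"] subsetD[OF s, of "s n"] g h by simp
  qed
  note bound = always_eventually[OF this]
  have "(\<lambda>n. nrm h * nrm (s n - g)) \<longlonglongrightarrow> 0"
    using tendsto_mult_left[OF lim, of "nrm h"] by simp
  from Lim_null_comparison[OF bound this] show ?thesis by (simp add: LIM_zero_iff)
qed

lemma tendsto_nrm:
  assumes s: "range s \<subseteq> H" and g: "g \<in> H" and lim: "(\<lambda>n. nrm (s n - g)) \<longlonglongrightarrow> 0"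
  shows "(\<lambda>n. nrm (s n)) \<longlonglongrightarrow> nrm g"
proof -
  have "\<bar>nrm (s n) - nrm g\<bar> \<le> nrm (s n - g)" for n
    using triangle_diff[of "s n" g] triangle_diff[of g "s n"] nrm_minus_commute[of g "s n"] subsetD[OF s, of "s n"] g
    by simp
  then have "(\<lambda>n. nrm (s n) - nrm g) \<longlonglongrightarrow> 0"
    by (intro Lim_null_comparison[OF always_eventually lim]) simp
  then show ?thesis by (simp add: LIM_zero_iff)
qed

text \<open>A bounded functional is given by its graph \<open>G\<close>; boundedness makes \<open>G\<close> single-valued, so
  no functional on a spanning set ever has to be shown to be well defined.\<close>

lemma riesz_graph:
  assumes GH: "\<And>x y. (x, y) \<in> G \<Longrightarrow> x \<in> H"
    and ne: "G \<noteq> {}"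
    and add: "\<And>x y x' y'. (x, y) \<in> G \<Longrightarrow> (x', y') \<in> G \<Longrightarrow> (x + x', y + y') \<in> G"
    and scale: "\<And>c x y. (x, y) \<in> G \<Longrightarrow> (cscale c x, c * y) \<in> G"
    and bound: "\<And>x y. (x, y) \<in> G \<Longrightarrow> cmod y \<le> C * nrm x"
    and C: "0 \<le> C"
  obtains g where "g \<in> H" "\<And>x y. (x, y) \<in> G \<Longrightarrow> ip x g = y"
    "\<And>e. e > 0 \<Longrightarrow> \<exists>x y. (x, y) \<in> G \<and> nrm (g - x) < e" "nrm g \<le> C"
proof -
  \<comment> \<open>If \<open>g\<close> represents the functional, \<open>J (x, y)\<close> is
    \<open>(nrm (x - g))\<^sup>2 - (nrm g)\<^sup>2\<close>, so \<open>g\<close> is found as the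
    limit of a minimising sequence of \<open>J\<close>.\<close>
  define J where "J = (\<lambda>p. (nrm (fst p))\<^sup>2 - 2 * Re (snd p))"
  have J_lower: "- C\<^sup>2 \<le> J p" if "p \<in> G" for p
  proof -
    obtain x y where p: "p = (x, y)" by (cases p)
    have "Re y \<le> C * nrm x" using bound[of x y] complex_Re_le_cmod[of y] that p by simp
    moreover have "0 \<le> (nrm x - C)\<^sup>2" by simp
    ultimately show ?thesis by (simp add: J_def p power2_diff algebra_simps)
  qed
  define m where "m = Inf (J ` G)"
  have bdd: "bdd_below (J ` G)" using J_lower by (auto intro!: bdd_belowI[of _ "- C\<^sup>2"])
  have m_le: "m \<le> J p" if "p \<in> G" for p
    unfolding m_def using bdd that by (auto intro: cInf_lower)
  have "\<exists>p\<in>G. J p < m + 1 / real (Suc n)" for n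
    using cInf_lessD[of "J ` G" "m + 1 / real (Suc n)"] ne by (auto simp: m_def)
  then obtain p where pG: "\<And>n. p n \<in> G" and pJ: "\<And>n. J (p n) < m + 1 / real (Suc n)" by metis
  define s where "s = (\<lambda>n. fst (p n))"
  define t where "t = (\<lambda>n. snd (p n))"
  have st: "(s n, t n) \<in> G" for n using pG[of n] by (simp add: s_def t_def)
  have Jp: "J (p n) = (nrm (s n))\<^sup>2 - 2 * Re (t n)" for n by (simp add: J_def s_def t_def)
  have sH: "s n \<in> H" for n using GH[OF st] .
  \<comment> \<open>Parallelogram law: the midpoint of two graph points is again in the graph, so
    its value of \<open>J\<close> is at least \<open>m\<close>, and near-minimisers must be
    close.\<close>
  have close: "(nrm (s i - s j))\<^sup>2 \<le> 2 / real (Suc i) + 2 / real (Suc j)" for i j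
  proof -
    have "(cscale (1/2) (s i + s j), (1/2) * (t i + t j)) \<in> G"
      by (intro scale add st)
    from m_le[OF this] have "m \<le> (nrm (s i + s j))\<^sup>2 / 4 - Re (t i + t j)"
      using sH by (simp add: J_def power_mult_distrib power_divide add_divide_distrib)
    moreover have "(nrm (s i + s j))\<^sup>2 + (nrm (s i - s j))\<^sup>2 = 2 * (nrm (s i))\<^sup>2 + 2 * (nrm (s j))\<^sup>2"
      using sH by (simp add: nrm_add_sq nrm_diff_sq)
    ultimately show ?thesis using pJ[of i] pJ[of j]
      by (simp add: Jp)
  qed
  have cauchy: "\<exists>N. \<forall>i\<ge>N. \<forall>j\<ge>N. nrm (s i - s j) < e" if "e > 0" for e
  proof -
    obtain N where N: "4 / e\<^sup>2 < real N" using reals_Archimedean2 by blast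
    have "nrm (s i - s j) < e" if ij: "i \<ge> N" "j \<ge> N" for i j
    proof -
      have Np: "0 < real N" using N \<open>e > 0\<close> by (meson divide_pos_pos less_trans zero_less_numeral zero_less_power)
      have "1 / real (Suc i) \<le> 1 / real N" "1 / real (Suc j) \<le> 1 / real N"
        using ij Np by (auto intro!: divide_left_mono)
      with close[of i j] have "(nrm (s i - s j))\<^sup>2 \<le> 4 / real N" by simp
      also have "\<dots> < e\<^sup>2" using N Np \<open>e > 0\<close> by (simp add: field_simps)
      finally show ?thesis by (rule power2_less_imp_less) (use \<open>e > 0\<close> in simp)
    qed
    then show ?thesis by blast
  qed
  obtain g where g: "g \<in> H" and lim: "(\<lambda>n. nrm (s n - g)) \<longlonglongrightarrow> 0"
    using hilbert cauchy sH unfolding hilbert_space_on_def by (metis image_subsetI)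
  have rs: "range s \<subseteq> H" using sH by auto
  have repr: "ip x g = y" if xy: "(x, y) \<in> G" for x y
  proof -
    have x: "x \<in> H" using GH[OF xy] .
    define d where "d = ip x g - y"
    \<comment> \<open>The first variation of \<open>J\<close> in direction \<open>x\<close> must
      vanish. The perturbation by \<open>r\<close> times \<open>x\<close> has linear part
      \<open>- 2 * q * (cmod d)\<^sup>2\<close>, and \<open>q * (nrm x)\<^sup>2 \<le> 1\<close>
      keeps the quadratic part below half of that, so \<open>d = 0\<close>.\<close>
    define q where "q = 1 / (1 + (nrm x)\<^sup>2)"
    have q: "0 < q" "q * (nrm x)\<^sup>2 \<le> 1"
      by (auto simp: q_def add_pos_nonneg)
    define r where "r = - complex_of_real q * cnj d"
    have pert: "0 \<le> 1 / real (Suc n) + 2 * Re (r * ip x (s n)) + (cmod r)\<^sup>2 * (nrm x)\<^sup>2 - 2 * Re (r * y)" for n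
    proof -
      have "(s n + cscale r x, t n + r * y) \<in> G" by (intro add scale st xy)
      from m_le[OF this] have "m \<le> (nrm (s n + cscale r x))\<^sup>2 - 2 * Re (t n) - 2 * Re (r * y)"
        by (simp add: J_def)
      moreover have "Re (ip (s n) (cscale r x)) = Re (r * ip x (s n))"
        using x sH[of n] ip_cnj[of "s n" x] by simp
      ultimately show ?thesis using pJ[of n] x sH[of n]
        by (simp add: Jp nrm_add_sq power_mult_distrib del: scale_right)
    qed
    have "(\<lambda>n. 1 / real (Suc n) + 2 * Re (r * ip x (s n)) + (cmod r)\<^sup>2 * (nrm x)\<^sup>2 - 2 * Re (r * y))
        \<longlonglongrightarrow> 0 + 2 * Re (r * ip x g) + (cmod r)\<^sup>2 * (nrm x)\<^sup>2 - 2 * Re (r * y)"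
      by (intro tendsto_intros tendsto_ip[OF rs g lim x] LIMSEQ_Suc[OF lim_1_over_n])
    then have "0 \<le> 0 + 2 * Re (r * ip x g) + (cmod r)\<^sup>2 * (nrm x)\<^sup>2 - 2 * Re (r * y)"
      by (rule LIMSEQ_le_const) (use pert in auto)
    also have "\<dots> = 2 * Re (r * d) + (cmod r)\<^sup>2 * (nrm x)\<^sup>2"
      by (simp add: d_def algebra_simps)
    also have "r * d = complex_of_real (- q * (cmod d)\<^sup>2)"
      by (simp only: of_real_mult of_real_minus complex_norm_square) (simp add: r_def)
    also have "cmod r = cmod d * q"
      using q by (simp add: r_def norm_mult)
    finally have "0 \<le> (q * (cmod d)\<^sup>2) * (q * (nrm x)\<^sup>2 - 2)"
      by (simp add: power2_eq_square algebra_simps)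
    also have "\<dots> \<le> (q * (cmod d)\<^sup>2) * (- 1)"
      using q by (intro mult_left_mono) auto
    finally have "(cmod d)\<^sup>2 = 0"
      using q by (simp add: mult_le_0_iff)
    then show "ip x g = y" by (simp add: d_def)
  qed
  \<comment> \<open>The minimising sequence lies in the domain of the graph and converges to
    \<open>g\<close>.\<close>
  have dense: "\<exists>x y. (x, y) \<in> G \<and> nrm (g - x) < e" if "e > 0" for e
  proof -
    from order_tendstoD(2)[OF lim that] obtain n where "nrm (s n - g) < e"
      by (auto simp: eventually_sequentially)
    then show ?thesis using st nrm_minus_commute[OF sH g] by metis
  qed
  \<comment> \<open>The bound is applied along the minimising sequence; in the limit it reads
    \<open>(nrm g)\<^sup>2 \<le> C * nrm g\<close>.\<close>
  have "cmod (ip g (s n)) \<le> C * nrm (s n)" for n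
    using bound[OF st[of n]] repr[OF st[of n]] ip_cnj[OF sH g] by (metis complex_mod_cnj)
  moreover have "(\<lambda>n. cmod (ip g (s n))) \<longlonglongrightarrow> cmod (ip g g)"
    by (intro tendsto_intros tendsto_ip[OF rs g lim g])
  moreover have "(\<lambda>n. C * nrm (s n)) \<longlonglongrightarrow> C * nrm g"
    by (intro tendsto_intros tendsto_nrm[OF rs g lim])
  ultimately have "cmod (ip g g) \<le> C * nrm g" by (meson LIMSEQ_le)
  then have "nrm g * nrm g \<le> C * nrm g" using g by (simp add: ip_self norm_mult power2_eq_square)
  then have "nrm g \<le> C"
    using C nrm_nonneg[OF g] by (cases "nrm g = 0") (auto simp: mult_le_cancel_right)
  with that g repr dense show thesis by blast
qed

lemma ip_eqD:
  assumes "f \<in> H" "g \<in> H" "\<And>h. h \<in> H \<Longrightarrow> ip h f = ip h g"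
  shows "f = g"
proof -
  have "ip (f - g) (f - g) = 0" using assms(3)[of "f - g"] assms(1,2) by (simp del: diff_left)
  then show ?thesis using ip_zeroD[of "f - g"] assms(1,2) by simp
qed

text \<open>With \<open>V = H\<close> this yields adjoints, and with \<open>V\<close> closed it
  yields orthogonal projections, because the representing vector stays in the closure of
  \<open>V\<close>.\<close>

lemma riesz_on:
  assumes V: "cfun.subspace V" "V \<subseteq> H" and C: "0 \<le> C"
    and add: "\<And>f g. f \<in> V \<Longrightarrow> g \<in> V \<Longrightarrow> L (f + g) = L f + L g"
    and scale: "\<And>c f. f \<in> V \<Longrightarrow> L (cscale c f) = c * L f"
    and bound: "\<And>f. f \<in> V \<Longrightarrow> cmod (L f) \<le> C * nrm f"
  obtains g where "g \<in> norm_closure_on H ip V" "\<And>f. f \<in> V \<Longrightarrow> ip f g = L f"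
proof -
  let ?G = "(\<lambda>f. (f, L f)) ` V"
  have G_mem: "x \<in> H" if "(x, y) \<in> ?G" for x y using that V by auto
  have G_ne: "?G \<noteq> {}" using cfun.subspace_0[OF V(1)] by auto
  have G_add: "(x + x', y + y') \<in> ?G" if "(x, y) \<in> ?G" "(x', y') \<in> ?G" for x y x' y'
    using that cfun.subspace_add[OF V(1)] by (auto simp: add image_iff)
  have G_scale: "(cscale c x, c * y) \<in> ?G" if "(x, y) \<in> ?G" for c x y
    using that cfun.subspace_scale[OF V(1)] by (auto simp: scale image_iff)
  have G_bound: "cmod y \<le> C * nrm x" if "(x, y) \<in> ?G" for x y
    using that by (auto simp: bound)
  obtain g where g: "g \<in> H"
    and repr: "\<And>x y. (x, y) \<in> ?G \<Longrightarrow> ip x g = y"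
    and dense: "\<And>e. e > 0 \<Longrightarrow> \<exists>x y. (x, y) \<in> ?G \<and> nrm (g - x) < e"
    and "nrm g \<le> C"
    by (rule riesz_graph[OF G_mem G_ne G_add G_scale G_bound C]) (assumption | rule that)+
  show thesis
  proof (rule that)
    show "g \<in> norm_closure_on H ip V"
      using g dense unfolding norm_closure_on_def by fastforce
    show "ip f g = L f" if "f \<in> V" for f
      using repr that by blast
  qed
qed

end

lemma sum_fun_apply: "(\<Sum>i\<in>I. f i) x = (\<Sum>i\<in>I. f i x)" for f :: "'i \<Rightarrow> 'a cfun"
  by (induction I rule: infinite_finite_induct) auto

subsection \<open>Reproducing kernels\<close>

locale rkhs =
  fixes X :: "'a set" and k :: "'a \<Rightarrow> 'a \<Rightarrow> complex"
    and H :: "'a cfun set" and ip :: "'a cfun \<Rightarrow> 'a cfun \<Rightarrow> complex"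
  assumes rkhs: "rkhs_on X k H ip"

sublocale rkhs \<subseteq> hilb
  using rkhs by unfold_locales (simp add: rkhs_on_def)

context rkhs
begin

definition K where "K w = (\<lambda>z. if z \<in> X then k z w else 0)"

lemma outside: "f \<in> H \<Longrightarrow> z \<notin> X \<Longrightarrow> f z = 0"
  using rkhs unfolding rkhs_on_def by blast

lemma K_mem: "w \<in> X \<Longrightarrow> K w \<in> H"
  and reproducing: "w \<in> X \<Longrightarrow> f \<in> H \<Longrightarrow> ip f (K w) = f w"
  using rkhs unfolding rkhs_on_def K_def by auto

lemma ip_K_left: "w \<in> X \<Longrightarrow> f \<in> H \<Longrightarrow> ip (K w) f = cnj (f w)"
  using ip_cnj[of f "K w"] K_mem reproducing by simp

definition comb :: "'a set \<Rightarrow> ('a \<Rightarrow> complex) \<Rightarrow> 'a cfun" where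
  "comb S c = (\<Sum>w\<in>S. cscale (c w) (K w))"

lemma comb_mem: "S \<subseteq> X \<Longrightarrow> comb S c \<in> H"
  unfolding comb_def by (intro sum_mem scale_mem K_mem) auto

lemma ip_comb:
  assumes "S \<subseteq> X" "f \<in> H"
  shows "ip (comb S c) f = (\<Sum>w\<in>S. c w * cnj (f w))"
proof -
  have "ip (comb S c) f = (\<Sum>w\<in>S. ip (cscale (c w) (K w)) f)"
    unfolding comb_def using assms by (intro sum_left) (auto simp: K_mem subset_iff)
  also have "\<dots> = (\<Sum>w\<in>S. c w * cnj (f w))"
    using assms by (intro sum.cong) (auto simp: K_mem ip_K_left subset_iff)
  finally show ?thesis .
qed

lemma comb_apply: "z \<in> X \<Longrightarrow> comb S c z = (\<Sum>w\<in>S. c w * k z w)"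
  by (simp add: comb_def sum_fun_apply cscale_def K_def)

lemma ip_comb_comb:
  assumes "S \<subseteq> X"
  shows "ip (comb S c) (comb S d) = (\<Sum>w\<in>S. \<Sum>v\<in>S. c w * cnj (d v) * cnj (k w v))"
  using assms by (simp add: ip_comb comb_mem comb_apply subset_iff sum_distrib_left mult_ac)

text \<open>If \<open>g\<close> were in \<open>H\<close>, pairing with it would send
  \<open>comb S c\<close> to the sum in \<open>bound\<close>. The graph of this rule satisfies
  \<open>riesz_graph\<close>, and the representing vector agrees with \<open>g\<close> at every
  point by the reproducing property. Approximability by kernel combinations comes with it.\<close>

lemma membership_and_density:
  assumes g0: "\<And>z. z \<notin> X \<Longrightarrow> g z = 0" and C: "0 \<le> C"
    and bound: "\<And>S c. finite S \<Longrightarrow> S \<subseteq> X \<Longrightarrow> cmod (\<Sum>w\<in>S. c w * cnj (g w)) \<le> C * nrm (comb S c)"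
  shows "g \<in> H \<and> nrm g \<le> C \<and> (\<forall>e>0. \<exists>S c. finite S \<and> S \<subseteq> X \<and> nrm (g - comb S c) < e)"
proof -
  define G where "G = {(comb S c, \<Sum>w\<in>S. c w * cnj (g w)) | S c. finite S \<and> S \<subseteq> X}"
  \<comment> \<open>Padding coefficients by 0 brings two combinations to a common index set, which
    gives additivity of \<open>G\<close>.\<close>
  have extend: "comb S c = comb T (\<lambda>w. if w \<in> S then c w else 0) \<and>
      (\<Sum>w\<in>S. c w * cnj (g w)) = (\<Sum>w\<in>T. (if w \<in> S then c w else 0) * cnj (g w))"
    if "finite T" "S \<subseteq> T" for S T c
    unfolding comb_def using that
    by (intro conjI sum.mono_neutral_cong_left) (auto simp: cscale_def fun_eq_iff)
  have G_mem: "x \<in> H" if "(x, y) \<in> G" for x y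
    using that by (auto simp: G_def comb_mem)
  have G_ne: "G \<noteq> {}" by (auto simp: G_def)
  have G_add: "(x + x', y + y') \<in> G" if xy: "(x, y) \<in> G" and xy': "(x', y') \<in> G" for x y x' y'
  proof -
    obtain S c where S: "finite S" "S \<subseteq> X" and x: "x = comb S c" and y: "y = (\<Sum>w\<in>S. c w * cnj (g w))"
      using xy by (auto simp: G_def)
    obtain T d where T: "finite T" "T \<subseteq> X" and x': "x' = comb T d" and y': "y' = (\<Sum>w\<in>T. d w * cnj (g w))"
      using xy' by (auto simp: G_def)
    define e where "e = (\<lambda>w. (if w \<in> S then c w else 0) + (if w \<in> T then d w else 0))"
    have eS: "x = comb (S \<union> T) (\<lambda>w. if w \<in> S then c w else 0)"
      "y = (\<Sum>w\<in>S \<union> T. (if w \<in> S then c w else 0) * cnj (g w))"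
      using extend[of "S \<union> T" S c] S T x y by auto
    have eT: "x' = comb (S \<union> T) (\<lambda>w. if w \<in> T then d w else 0)"
      "y' = (\<Sum>w\<in>S \<union> T. (if w \<in> T then d w else 0) * cnj (g w))"
      using extend[of "S \<union> T" T d] S T x' y' by auto
    have "x + x' = comb (S \<union> T) e"
      unfolding eS(1) eT(1) comb_def sum.distrib[symmetric]
      by (rule sum.cong[OF refl]) (auto simp: e_def cscale_def fun_eq_iff algebra_simps)
    moreover have "y + y' = (\<Sum>w\<in>S \<union> T. e w * cnj (g w))"
      unfolding eS(2) eT(2) sum.distrib[symmetric]
      by (rule sum.cong[OF refl]) (auto simp: e_def algebra_simps)
    ultimately show ?thesis using S T by (auto simp: G_def)
  qed
  have G_scale: "(cscale r x, r * y) \<in> G" if xy: "(x, y) \<in> G" for r x y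
  proof -
    obtain S c where S: "finite S" "S \<subseteq> X" and x: "x = comb S c" and y: "y = (\<Sum>w\<in>S. c w * cnj (g w))"
      using xy by (auto simp: G_def)
    have "cscale r x = comb S (\<lambda>w. r * c w)"
      unfolding x comb_def cfun.scale_sum_right by simp
    moreover have "r * y = (\<Sum>w\<in>S. (r * c w) * cnj (g w))"
      by (simp add: y sum_distrib_left mult_ac)
    ultimately show ?thesis using S by (auto simp: G_def)
  qed
  have G_bound: "cmod y \<le> C * nrm x" if "(x, y) \<in> G" for x y
    using that bound by (auto simp: G_def)
  obtain h where h: "h \<in> H"
    and repr: "\<And>x y. (x, y) \<in> G \<Longrightarrow> ip x h = y"
    and dense: "\<And>e. e > 0 \<Longrightarrow> \<exists>x y. (x, y) \<in> G \<and> nrm (h - x) < e"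
    and h_le: "nrm h \<le> C"
    by (rule riesz_graph[OF G_mem G_ne G_add G_scale G_bound C]) (assumption | rule that)+
  have "h = g"
  proof
    fix z
    show "h z = g z"
    proof (cases "z \<in> X")
      case True
      have "comb {z} (\<lambda>_. 1) = K z" by (simp add: comb_def)
      then have "(K z, cnj (g z)) \<in> G"
        unfolding G_def using True by (auto intro!: exI[of _ "{z}"] exI[of _ "\<lambda>_. 1"])
      from repr[OF this] show ?thesis using ip_K_left[OF True h] by simp
    qed (use g0 outside h in auto)
  qed
  moreover have "\<exists>S c. finite S \<and> S \<subseteq> X \<and> nrm (h - comb S c) < e" if "e > 0" for e
    using dense[OF that] by (auto simp: G_def)
  ultimately show ?thesis using h h_le by blast
qed

lemma membership:
  assumes "\<And>z. z \<notin> X \<Longrightarrow> g z = 0" "0 \<le> C"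
    and "\<And>S c. finite S \<Longrightarrow> S \<subseteq> X \<Longrightarrow> cmod (\<Sum>w\<in>S. c w * cnj (g w)) \<le> C * nrm (comb S c)"
  shows "g \<in> H" "nrm g \<le> C"
  using membership_and_density[of g C] assms by blast+

text \<open>Cauchy-Schwarz supplies the bound in \<open>membership_and_density\<close> with
  \<open>g = f\<close> and \<open>C = nrm f\<close>.\<close>

lemma comb_dense:
  assumes f: "f \<in> H" and e: "e > 0"
  obtains S c where "finite S" "S \<subseteq> X" "nrm (f - comb S c) < e"
proof -
  have "cmod (\<Sum>w\<in>S. c w * cnj (f w)) \<le> nrm f * nrm (comb S c)" if "finite S" "S \<subseteq> X" for S c
    using cauchy_schwarz[OF comb_mem[OF that(2), of c] f] ip_comb[OF that(2) f, of c] by (simp add: mult.commute)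
  with membership_and_density[of f "nrm f"] outside[OF f] f e that show thesis by auto
qed

end

subsection \<open>Monomials indexed by words\<close>

text \<open>Summing over words instead of multi-indices makes the multinomial coefficients disappear.\<close>

definition word_monom :: "'d list \<Rightarrow> complex ^ 'd \<Rightarrow> complex" where
  "word_monom p z = (\<Prod>i\<leftarrow>p. z $ i)"

lemma word_monom_Nil [simp]: "word_monom [] z = 1"
  and word_monom_Cons [simp]: "word_monom (i # p) z = z $ i * word_monom p z"
  by (auto simp: word_monom_def)

lemma lists_length_Suc: "{p. length p = Suc n} = (\<lambda>(i, q). i # q) ` (UNIV \<times> {q. length q = n})"
  by (auto simp: length_Suc_conv image_iff)

lemma finite_lists_length: "finite {p :: 'd::finite list. length p = n}"
  using finite_lists_length_eq[of "UNIV :: 'd set" n] by simp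

text \<open>Multiplying out the \<open>n\<close>-th power of the inner product gives exactly one
  term for each word of length \<open>n\<close>.\<close>

lemma sum_word_monom:
  fixes v w :: "complex ^ 'd"
  shows "(\<Sum>p | length p = n. word_monom p v * cnj (word_monom p w)) = cinner v w ^ n"
proof (induction n)
  case (Suc n)
  have inj: "inj_on (\<lambda>(i, q). i # q) (UNIV \<times> {q :: 'd list. length q = n})"
    by (auto simp: inj_on_def)
  have "(\<Sum>p | length p = Suc n. word_monom p v * cnj (word_monom p w))
      = (\<Sum>(i, q)\<in>UNIV \<times> {q. length q = n}. (v $ i * cnj (w $ i)) * (word_monom q v * cnj (word_monom q w)))"
    unfolding lists_length_Suc by (subst sum.reindex[OF inj]) (auto intro!: sum.cong simp: mult_ac)
  also have "\<dots> = cinner v w * (\<Sum>q | length q = n. word_monom q v * cnj (word_monom q w))"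
    unfolding cinner_def sum_product sum.cartesian_product by simp
  finally show ?case by (simp add: Suc.IH)
qed simp

text \<open>The empty word is excluded because \<open>1 - 1/k\<close> has no constant term.\<close>

definition words :: "nat \<Rightarrow> 'd list set" where
  "words N = {p. p \<noteq> [] \<and> length p \<le> N}"

lemma words_UN: "words N = (\<Union>n\<in>{1..N}. {p. length p = n})"
  by (auto simp: words_def Suc_le_eq)

lemma finite_words [simp]: "finite (words N :: 'd::finite list set)"
  unfolding words_UN by (auto simp: finite_lists_length)

lemma sum_words:
  fixes f :: "'d::finite list \<Rightarrow> 'b::comm_semiring_0"
  shows "(\<Sum>p\<in>words N. c (length p) * f p) = (\<Sum>n=1..N. c n * (\<Sum>p | length p = n. f p))"
proof -
  have "(\<Sum>p\<in>words N. c (length p) * f p) = (\<Sum>n=1..N. \<Sum>p | length p = n. c (length p) * f p)"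
    unfolding words_UN by (intro sum.UNION_disjoint) (auto simp: finite_lists_length)
  then show ?thesis by (simp add: sum_distrib_left)
qed

lemma sum_words_monom:
  fixes v w :: "complex ^ 'd"
  shows "(\<Sum>p\<in>words N. c (length p) * (word_monom p v * cnj (word_monom p w))) = (\<Sum>n=1..N. c n * cinner v w ^ n)"
  unfolding sum_words[of c "\<lambda>p. word_monom p v * cnj (word_monom p w)"] sum_word_monom ..

lemma ui_kernel_0_left: "ui_kernel a 0 w = of_real (a 0)"
  by (simp add: ui_kernel_def cinner_def powser_zero)

definition ball_monom :: "'d list \<Rightarrow> (complex ^ 'd) cfun" where
  "ball_monom p = (\<lambda>z. if z \<in> ball 0 1 then word_monom p z else 0)"

subsection \<open>Complete Nevanlinna--Pick spaces\<close>

locale cnp =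
  fixes H :: "(complex ^ 'd) cfun set" and ip a b
  assumes cnp: "regular_ui_cnp_space H ip a b"

sublocale cnp \<subseteq> rkhs "ball 0 1" "ui_kernel a" H ip
  using cnp by unfold_locales (simp add: regular_ui_cnp_space_def)

context cnp
begin

lemma a_0: "a 0 = 1" and a_pos: "a n > 0" and a_ratio: "(\<lambda>n. a n / a (Suc n)) \<longlonglongrightarrow> 1"
  and b_nonneg: "n \<ge> 1 \<Longrightarrow> b n \<ge> 0"
  and kernel_nz: "z \<in> ball (0 :: complex ^ 'd) 1 \<Longrightarrow> w \<in> ball 0 1 \<Longrightarrow> ui_kernel a z w \<noteq> 0"
  and kernel_sums: "z \<in> ball (0 :: complex ^ 'd) 1 \<Longrightarrow> w \<in> ball 0 1 \<Longrightarrow>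
    (\<lambda>n. complex_of_real (b (Suc n)) * cinner z w ^ Suc n) sums (1 - 1 / ui_kernel a z w)"
  using cnp unfolding regular_ui_cnp_space_def by blast+

lemma b_words_nonneg: "p \<in> words N \<Longrightarrow> b (length p) \<ge> 0"
  by (intro b_nonneg) (auto simp: words_def Suc_le_eq)

text \<open>The series of \<open>1 - 1/k\<close> multiplied by \<open>k\<close>: this is the
  identity \<open>R R* = I - 1 \<otimes> 1\<close> tested on kernel functions.\<close>

lemma kernel_tendsto:
  fixes z w :: "complex ^ 'd"
  assumes "z \<in> ball 0 1" "w \<in> ball 0 1"
  shows "(\<lambda>N. (\<Sum>n=1..N. complex_of_real (b n) * cinner z w ^ n) * ui_kernel a z w) \<longlonglongrightarrow> ui_kernel a z w - 1"
proof -
  have "(\<Sum>n<N. complex_of_real (b (Suc n)) * cinner z w ^ Suc n) = (\<Sum>n=1..N. complex_of_real (b n) * cinner z w ^ n)" for N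
    using sum.shift_bounds_Suc_ivl[of "\<lambda>n. complex_of_real (b n) * cinner z w ^ n" 0 N]
    by (simp add: atLeast0LessThan atLeastLessThanSuc_atLeastAtMost)
  with kernel_sums[OF assms] have "(\<lambda>N. \<Sum>n=1..N. complex_of_real (b n) * cinner z w ^ n) \<longlonglongrightarrow> 1 - 1 / ui_kernel a z w"
    by (simp add: sums_def)
  from tendsto_mult_right[OF this, of "ui_kernel a z w"] show ?thesis
    using kernel_nz[OF assms] by (simp add: algebra_simps)
qed

text \<open>The image of \<open>comb S c\<close> under the adjoint of multiplication by the monomial
  of \<open>p\<close>. It is written out on kernel functions because that multiplication is not yet
  known to be bounded; \<open>adj_comb\<close> identifies the two later.\<close>

definition shift_comb :: "'d list \<Rightarrow> (complex ^ 'd) set \<Rightarrow> (complex ^ 'd \<Rightarrow> complex) \<Rightarrow> (complex ^ 'd) cfun" where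
  "shift_comb p S c = comb S (\<lambda>w. c w * cnj (word_monom p w))"

lemma shift_comb_mem: "S \<subseteq> ball 0 1 \<Longrightarrow> shift_comb p S c \<in> H"
  by (simp add: shift_comb_def comb_mem)

text \<open>Expanding the Gram sums and summing over words first turns the monomials into partial
  sums of \<open>1 - 1/k\<close>.\<close>

lemma sum_shift_comb:
  assumes S: "S \<subseteq> ball 0 1"
  shows "complex_of_real (\<Sum>p\<in>words N. b (length p) * (nrm (shift_comb p S c))\<^sup>2)
    = (\<Sum>w\<in>S. \<Sum>v\<in>S. c w * cnj (c v) * cnj ((\<Sum>n=1..N. complex_of_real (b n) * cinner w v ^ n) * ui_kernel a w v))"
proof -
  have "complex_of_real (\<Sum>p\<in>words N. b (length p) * (nrm (shift_comb p S c))\<^sup>2)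
      = (\<Sum>p\<in>words N. of_real (b (length p)) * ip (shift_comb p S c) (shift_comb p S c))"
    using S by (simp add: ip_self shift_comb_mem)
  also have "\<dots> = (\<Sum>p\<in>words N. \<Sum>w\<in>S. \<Sum>v\<in>S. c w * cnj (c v) * cnj (ui_kernel a w v) *
      cnj (of_real (b (length p)) * (word_monom p w * cnj (word_monom p v))))"
    using S by (simp add: shift_comb_def ip_comb_comb sum_distrib_left mult_ac)
  also have "\<dots> = (\<Sum>w\<in>S. \<Sum>p\<in>words N. \<Sum>v\<in>S. c w * cnj (c v) * cnj (ui_kernel a w v) *
      cnj (of_real (b (length p)) * (word_monom p w * cnj (word_monom p v))))"
    by (rule sum.swap)
  also have "\<dots> = (\<Sum>w\<in>S. \<Sum>v\<in>S. \<Sum>p\<in>words N. c w * cnj (c v) * cnj (ui_kernel a w v) *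
      cnj (of_real (b (length p)) * (word_monom p w * cnj (word_monom p v))))"
    by (intro sum.cong[OF refl] sum.swap)
  also have "\<dots> = (\<Sum>w\<in>S. \<Sum>v\<in>S. c w * cnj (c v) * cnj (ui_kernel a w v) *
      cnj (\<Sum>p\<in>words N. of_real (b (length p)) * (word_monom p w * cnj (word_monom p v))))"
    by (simp only: sum_distrib_left cnj_sum)
  finally show ?thesis
    unfolding sum_words_monom[of "\<lambda>n. of_real (b n)"] by (simp add: mult_ac)
qed

text \<open>On kernel combinations, the adjoint of R preserves the norm up to the value at the
  origin; this is where the rank one term of \<open>I - 1 \<otimes> 1\<close> enters.\<close>

lemma shift_comb_tendsto:
  assumes S: "S \<subseteq> ball 0 1"
  shows "(\<lambda>N. \<Sum>p\<in>words N. b (length p) * (nrm (shift_comb p S c))\<^sup>2) \<longlonglongrightarrow>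
    (nrm (comb S c))\<^sup>2 - (cmod (comb S c 0))\<^sup>2" (is "?Q \<longlonglongrightarrow> ?L")
proof -
  have "(\<lambda>N. complex_of_real (?Q N)) \<longlonglongrightarrow> (\<Sum>w\<in>S. \<Sum>v\<in>S. c w * cnj (c v) * cnj (ui_kernel a w v - 1))"
    unfolding sum_shift_comb[OF S] using S by (intro tendsto_intros kernel_tendsto) auto
  also have "(\<Sum>w\<in>S. \<Sum>v\<in>S. c w * cnj (c v) * cnj (ui_kernel a w v - 1))
      = ip (comb S c) (comb S c) - (\<Sum>w\<in>S. c w) * cnj (\<Sum>w\<in>S. c w)"
    using S by (simp add: ip_comb_comb sum_product sum_subtractf algebra_simps)
  \<comment> \<open>The kernel is constantly \<open>a 0 = 1\<close> when one argument is the
    origin.\<close>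
  also have "(\<Sum>w\<in>S. c w) = comb S c 0"
    by (simp add: comb_apply ui_kernel_0_left a_0)
  finally have "(\<lambda>N. complex_of_real (?Q N)) \<longlonglongrightarrow> complex_of_real ?L"
    using S by (simp add: ip_self comb_mem complex_norm_square flip: of_real_power)
  then show ?thesis by (simp only: tendsto_of_real_iff)
qed

text \<open>The truncated sums increase with \<open>N\<close>, since \<open>b\<close> is nonnegative
  from index 1 on, so each lies below the limit.\<close>

lemma sum_shift_comb_le:
  assumes S: "S \<subseteq> ball 0 1"
  shows "(\<Sum>p\<in>words N. b (length p) * (nrm (shift_comb p S c))\<^sup>2) \<le> (nrm (comb S c))\<^sup>2" (is "?Q N \<le> _")
proof -
  have "words n \<subseteq> (words (Suc n) :: 'd list set)" for n by (auto simp: words_def)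
  then have "incseq ?Q"
    by (intro incseq_SucI sum_mono2) (auto intro!: mult_nonneg_nonneg intro: b_words_nonneg)
  from incseq_le[OF this shift_comb_tendsto[OF S]] have "?Q N \<le> (nrm (comb S c))\<^sup>2 - (cmod (comb S c 0))\<^sup>2" .
  also have "\<dots> \<le> (nrm (comb S c))\<^sup>2" by simp
  finally show ?thesis .
qed

text \<open>The dual of \<open>sum_shift_comb_le\<close>: the adjoint of the row is contractive on
  kernel combinations, and \<open>membership\<close> converts this into membership in
  \<open>H\<close> together with the norm bound. The subset \<open>W\<close> allows rows with a
  single entry.\<close>

lemma row_contraction:
  assumes W: "W \<subseteq> words N" and h: "\<And>p. p \<in> W \<Longrightarrow> h p \<in> H"
  defines "g \<equiv> \<Sum>p\<in>W. cscale (sqrt (b (length p))) (ball_monom p * h p)"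
  shows "g \<in> H" "nrm g \<le> sqrt (\<Sum>p\<in>W. (nrm (h p))\<^sup>2)"
proof -
  have g0: "g z = 0" if "z \<notin> ball 0 1" for z
    using that by (simp add: g_def sum_fun_apply cscale_def ball_monom_def)
  have "cmod (\<Sum>w\<in>S. c w * cnj (g w)) \<le> sqrt (\<Sum>p\<in>W. (nrm (h p))\<^sup>2) * nrm (comb S c)"
    if S: "finite S" "S \<subseteq> ball 0 1" for S c
  proof -
    have "(\<Sum>w\<in>S. c w * cnj (g w)) = (\<Sum>w\<in>S. \<Sum>p\<in>W. sqrt (b (length p)) * ((c w * cnj (word_monom p w)) * cnj (h p w)))"
      using S by (intro sum.cong) (auto simp: g_def sum_fun_apply cscale_def ball_monom_def sum_distrib_left mult_ac)
    also have "\<dots> = (\<Sum>p\<in>W. sqrt (b (length p)) * ip (shift_comb p S c) (h p))"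
      using S h by (subst sum.swap) (simp add: shift_comb_def ip_comb sum_distrib_left)
    \<comment> \<open>Cauchy-Schwarz is used twice: in \<open>H\<close> for each word, then for the
      sum over words.\<close>
    also have "cmod \<dots> \<le> (\<Sum>p\<in>W. \<bar>sqrt (b (length p)) * nrm (shift_comb p S c)\<bar> * \<bar>nrm (h p)\<bar>)"
    proof (intro sum_norm_le)
      fix p assume p: "p \<in> W"
      have "\<bar>sqrt (b (length p))\<bar> * cmod (ip (shift_comb p S c) (h p))
          \<le> \<bar>sqrt (b (length p))\<bar> * (nrm (shift_comb p S c) * nrm (h p))"
        using S h p by (intro mult_left_mono cauchy_schwarz shift_comb_mem) auto
      then show "cmod (sqrt (b (length p)) * ip (shift_comb p S c) (h p))
          \<le> \<bar>sqrt (b (length p)) * nrm (shift_comb p S c)\<bar> * \<bar>nrm (h p)\<bar>"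
        using S h p by (simp add: norm_mult abs_mult shift_comb_mem mult_ac)
    qed
    also have "\<dots> \<le> L2_set (\<lambda>p. sqrt (b (length p)) * nrm (shift_comb p S c)) W * L2_set (\<lambda>p. nrm (h p)) W"
      by (rule L2_set_mult_ineq)
    also have "L2_set (\<lambda>p. sqrt (b (length p)) * nrm (shift_comb p S c)) W \<le> nrm (comb S c)"
    proof -
      have "(\<Sum>p\<in>W. (sqrt (b (length p)) * nrm (shift_comb p S c))\<^sup>2)
          = (\<Sum>p\<in>W. b (length p) * (nrm (shift_comb p S c))\<^sup>2)"
        using W b_words_nonneg by (intro sum.cong) (auto simp: power_mult_distrib)
      also have "\<dots> \<le> (\<Sum>p\<in>words N. b (length p) * (nrm (shift_comb p S c))\<^sup>2)"
        using W by (intro sum_mono2) (auto intro!: mult_nonneg_nonneg intro: b_words_nonneg)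
      also have "\<dots> \<le> (nrm (comb S c))\<^sup>2" by (rule sum_shift_comb_le[OF S(2)])
      finally show ?thesis
        unfolding L2_set_def using comb_mem[OF S(2)] by (intro real_le_lsqrt) (auto intro: sum_nonneg)
    qed
    finally show ?thesis
      by (simp add: L2_set_def mult.commute mult_right_mono sum_nonneg)
  qed
  note bound = this
  show "g \<in> H" "nrm g \<le> sqrt (\<Sum>p\<in>W. (nrm (h p))\<^sup>2)"
    using membership[of g "sqrt (\<Sum>p\<in>W. (nrm (h p))\<^sup>2)"] g0 bound by (auto simp: sum_nonneg)
qed

end

lemma cinner_axis: "cinner (axis i x) (axis i y) = x * cnj y"
proof -
  have "cinner (axis i x) (axis i y) = (\<Sum>j\<in>UNIV. if j = i then x * cnj y else 0)"
    unfolding cinner_def by (rule sum.cong) (auto simp: axis_def)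
  then show ?thesis by simp
qed

lemma norm_axis_complex: "norm (axis i x :: complex ^ 'd) = cmod x"
proof -
  have "(\<Sum>j\<in>UNIV. (cmod ((axis i x :: complex ^ 'd) $ j))\<^sup>2) = (\<Sum>j\<in>UNIV. if j = i then (cmod x)\<^sup>2 else 0)"
    by (rule sum.cong) (auto simp: axis_def)
  then show ?thesis by (simp add: norm_vec_def L2_set_def)
qed

section \<open>Power series relations between the coefficients \<open>a\<close> and
  \<open>b\<close>\<close>

context cnp
begin

lemma conv_radius_a: "conv_radius (\<lambda>n. complex_of_real (a n)) = 1"
  using a_ratio a_pos
  by (intro conv_radius_ratio_limit_nonzero[of _ 1]) (auto simp: one_ereal_def less_imp_le)

lemma axis_series:
  assumes "cmod x < 1/2"
  shows "(\<Sum>n. complex_of_real (a n) * x ^ n) \<noteq> 0"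
    "(\<lambda>n. complex_of_real (b (Suc n)) * x ^ Suc n) sums (1 - 1 / (\<Sum>n. complex_of_real (a n) * x ^ n))"
proof -
  fix i :: 'd
  \<comment> \<open>For \<open>cmod x < 1/2\<close> both points lie in the ball and their inner
    product is \<open>x\<close>, which reduces the kernel identities to one complex
    variable.\<close>
  have z: "(axis i (2 * x) :: complex ^ 'd) \<in> ball 0 1" "(axis i (1/2) :: complex ^ 'd) \<in> ball 0 1"
    using assms by (auto simp: norm_axis_complex norm_mult)
  have "cinner (axis i (2 * x) :: complex ^ 'd) (axis i (1/2)) = x" by (simp add: cinner_axis)
  then show "(\<Sum>n. complex_of_real (a n) * x ^ n) \<noteq> 0"
    "(\<lambda>n. complex_of_real (b (Suc n)) * x ^ Suc n) sums (1 - 1 / (\<Sum>n. complex_of_real (a n) * x ^ n))"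
    using kernel_nz[OF z] kernel_sums[OF z] by (simp_all add: ui_kernel_def)
qed

text \<open>The constant term is set to 0 to match \<open>1 - 1/k\<close>, whatever the value of
  \<open>b 0\<close>.\<close>

definition "b_fps = Abs_fps (\<lambda>n. if n = 0 then 0 else complex_of_real (b n))"
definition "a_fps = Abs_fps (\<lambda>n. complex_of_real (a n))"

text \<open>By \<open>axis_series\<close> both sides have the same values on a small disc, and the
  identity theorem for power series turns this into a formal identity.\<close>

lemma a_fps_mult: "a_fps * (1 - b_fps) = 1"
proof (rule eval_fps_eqD)
  have ra: "fps_conv_radius a_fps = 1"
    unfolding fps_conv_radius_def a_fps_def by (simp add: conv_radius_a)
  have eval_b: "(\<lambda>n. fps_nth b_fps n * x ^ n) sums (1 - 1 / eval_fps a_fps x)" if "cmod x < 1/2" for x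
  proof -
    have "(\<lambda>n. fps_nth b_fps (Suc n) * x ^ Suc n) sums (1 - 1 / eval_fps a_fps x)"
      using axis_series(2)[OF that] by (simp add: b_fps_def a_fps_def eval_fps_def)
    then show ?thesis by (subst (asm) sums_Suc_iff) (simp add: b_fps_def)
  qed
  \<comment> \<open>Convergence at the single point \<open>1/4\<close>, inside the disc of
    \<open>eval_b\<close>, bounds the radius of convergence from below.\<close>
  have "summable (\<lambda>n. fps_nth b_fps n * (1/4) ^ n)"
    using eval_b[of "1/4"] by (auto simp: sums_iff)
  from conv_radius_geI[OF this] have rb: "fps_conv_radius b_fps \<ge> ereal (1/4)"
    by (simp add: fps_conv_radius_def)
  have r1: "fps_conv_radius (1 - b_fps) \<ge> ereal (1/4)"
    using fps_conv_radius_diff[of 1 b_fps] rb by (auto simp: min_def intro: order_trans split: if_splits)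
  show "fps_conv_radius (a_fps * (1 - b_fps)) > 0"
  proof -
    have "(0 :: ereal) < min (fps_conv_radius a_fps) (fps_conv_radius (1 - b_fps))"
      using ra r1 by (auto simp: less_le_trans[of 0 "ereal (1/4)"])
    also have "\<dots> \<le> fps_conv_radius (a_fps * (1 - b_fps))" by (rule fps_conv_radius_mult)
    finally show ?thesis .
  qed
  have "eval_fps (a_fps * (1 - b_fps)) x = eval_fps 1 x" if x: "x \<in> ball 0 (1/4)" for x
  proof -
    have x4: "ereal (cmod x) < ereal (1/4)" using x by simp
    have "eval_fps b_fps x = 1 - 1 / eval_fps a_fps x"
      using eval_b[of x] x by (simp add: sums_iff eval_fps_def)
    moreover have "eval_fps a_fps x \<noteq> 0"
      using axis_series(1)[of x] x by (simp add: a_fps_def eval_fps_def)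
    moreover have "ereal (cmod x) < 1" using x by (simp add: one_ereal_def)
    ultimately show ?thesis
      using ra less_le_trans[OF x4 rb] less_le_trans[OF x4 r1]
      by (simp add: eval_fps_mult eval_fps_diff)
  qed
  then show "eventually (\<lambda>x. eval_fps (a_fps * (1 - b_fps)) x = eval_fps 1 x) (nhds 0)"
    by (intro eventually_mono[OF eventually_nhds_in_open[of "ball 0 (1/4)" 0]]) auto
qed simp

lemma a_rec: "a (Suc n) = (\<Sum>j\<le>n. a j * b (Suc n - j))"
proof -
  have "a_fps = 1 + a_fps * b_fps" using a_fps_mult by (simp add: algebra_simps)
  then have "fps_nth a_fps (Suc n) = fps_nth (1 + a_fps * b_fps) (Suc n)" by simp
  then have "complex_of_real (a (Suc n)) = (\<Sum>j\<le>Suc n. complex_of_real (a j) * fps_nth b_fps (Suc n - j))"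
    by (simp add: fps_mult_nth a_fps_def atLeast0AtMost)
  \<comment> \<open>The top term \<open>j = Suc n\<close> drops out because \<open>b_fps\<close> has
    constant term 0.\<close>
  also have "\<dots> = (\<Sum>j\<le>n. complex_of_real (a j) * fps_nth b_fps (Suc n - j))"
    by (simp add: b_fps_def)
  also have "\<dots> = complex_of_real (\<Sum>j\<le>n. a j * b (Suc n - j))"
    unfolding of_real_sum by (rule sum.cong) (auto simp: b_fps_def)
  finally show ?thesis by (simp only: of_real_eq_iff)
qed

text \<open>The recursion gives \<open>a 1 = b 1\<close>. Dividing by \<open>sqrt (b 1)\<close>
  later shows that the coordinates are multipliers.\<close>

lemma b_1_pos: "b 1 > 0"
  using a_rec[of 0] a_pos[of 1] by (simp add: a_0)

text \<open>Under the hypothesis, \<open>a_rec\<close> keeps \<open>a n * t ^ n\<close> below 1 by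
  strong induction. For \<open>t > 1\<close> the series of \<open>a\<close> would then converge
  beyond its radius of convergence 1.\<close>

lemma le_1_if_b_series_le_1:
  assumes t: "0 \<le> t" and le: "\<And>N. (\<Sum>n=1..N. b n * t ^ n) \<le> 1"
  shows "t \<le> 1"
proof (rule ccontr)
  assume "\<not> t \<le> 1"
  have a_le: "a n * t ^ n \<le> 1" for n
  proof (induction n rule: less_induct)
    case (less n)
    show ?case
    proof (cases n)
      case (Suc m)
      have "a n * t ^ n = (\<Sum>j\<le>m. (a j * t ^ j) * (b (Suc m - j) * t ^ (Suc m - j)))"
      proof -
        have "a j * b (Suc m - j) * t ^ Suc m = (a j * t ^ j) * (b (Suc m - j) * t ^ (Suc m - j))" if "j \<le> m" for j
        proof -
          have "t ^ Suc m = t ^ j * t ^ (Suc m - j)" using that by (simp flip: power_add)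
          then show ?thesis by simp
        qed
        then show ?thesis unfolding Suc a_rec sum_distrib_right by (intro sum.cong) auto
      qed
      also have "\<dots> \<le> (\<Sum>j\<le>m. 1 * (b (Suc m - j) * t ^ (Suc m - j)))"
        using less Suc t b_nonneg by (intro sum_mono mult_right_mono) auto
      also have "\<dots> = (\<Sum>i=1..Suc m. b i * t ^ i)"
        by (rule sum.reindex_bij_witness[of _ "\<lambda>i. Suc m - i" "\<lambda>j. Suc m - j"]) auto
      also have "\<dots> \<le> 1" by (rule le)
      finally show ?thesis .
    qed (simp add: a_0)
  qed
  \<comment> \<open>A point strictly between 1 and \<open>t\<close>: the terms at \<open>s\<close>
    are dominated by the geometric series of ratio \<open>s / t\<close>.\<close>
  define s where "s = (1 + t) / 2"
  have s: "1 < s" "s < t" using \<open>\<not> t \<le> 1\<close> by (auto simp: s_def)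
  have "norm (complex_of_real (a n) * complex_of_real s ^ n) \<le> (s / t) ^ n" for n
  proof -
    have "a n \<le> 1 / t ^ n" using a_le[of n] s by (simp add: field_simps)
    then have "a n * s ^ n \<le> (1 / t ^ n) * s ^ n" using s by (intro mult_right_mono) auto
    then show ?thesis
      using a_pos[of n] s by (simp add: norm_mult norm_power power_divide)
  qed
  then have "summable (\<lambda>n. complex_of_real (a n) * complex_of_real s ^ n)"
    using s by (intro summable_comparison_test'[OF summable_geometric[of "s / t"]]) auto
  from conv_radius_geI[OF this] show False
    using s by (simp add: conv_radius_a one_ereal_def)
qed

text \<open>On the diagonal the kernel is real and at least 1, so \<open>1 - 1/k\<close> is at most
  1 there; the bound at radius 1 follows by continuity of finite sums.\<close>

lemma b_partial_sum_le_1: "(\<Sum>n=1..N. b n) \<le> 1"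
proof -
  have le: "(\<Sum>n=1..N. b n * r ^ n) \<le> 1" if r: "0 \<le> r" "r < 1" for r
  proof -
    fix i :: 'd
    \<comment> \<open>This point of the ball satisfies \<open>cinner z z = r\<close>.\<close>
    define z where "z = (axis i (complex_of_real (sqrt r)) :: complex ^ 'd)"
    have z: "z \<in> ball 0 1" using r by (simp add: z_def norm_axis_complex)
    have zz: "cinner z z = complex_of_real r"
      using r by (simp add: z_def cinner_axis flip: of_real_mult)
    have sum_a: "summable (\<lambda>n. a n * r ^ n)"
    proof -
      have "summable (\<lambda>n. complex_of_real (a n) * complex_of_real r ^ n)"
        using r by (intro summable_in_conv_radius) (simp add: conv_radius_a one_ereal_def)
      then show ?thesis by (simp flip: of_real_power of_real_mult add: summable_of_real_iff)
    qed
    define k where "k = (\<Sum>n. a n * r ^ n)"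
    have "(\<Sum>n<1. a n * r ^ n) \<le> k"
      unfolding k_def using r a_pos by (intro sum_le_suminf[OF sum_a]) (auto simp: less_imp_le)
    then have k: "k \<ge> 1" by (simp add: a_0)
    have "ui_kernel a z z = complex_of_real k"
      unfolding ui_kernel_def zz k_def by (simp add: suminf_of_real[OF sum_a])
    with kernel_sums[OF z z] have "(\<lambda>n. complex_of_real (b (Suc n) * r ^ Suc n)) sums complex_of_real (1 - 1 / k)"
      by (simp add: zz)
    then have sums: "(\<lambda>n. b (Suc n) * r ^ Suc n) sums (1 - 1 / k)"
      by (simp only: sums_of_real_iff)
    have "(\<Sum>n=1..N. b n * r ^ n) = (\<Sum>n<N. b (Suc n) * r ^ Suc n)"
      by (rule sum.reindex_bij_witness[of _ Suc "\<lambda>n. n - 1"]) auto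
    also have "\<dots> \<le> (\<Sum>n. b (Suc n) * r ^ Suc n)"
      using sums r b_nonneg by (intro sum_le_suminf) (auto simp: sums_iff simp del: power_Suc)
    also have "\<dots> \<le> 1" using sums k by (simp add: sums_iff)
    finally show ?thesis .
  qed
  have "(\<lambda>m. \<Sum>n=1..N. b n * (1 - 1 / real (Suc m)) ^ n) \<longlonglongrightarrow> (\<Sum>n=1..N. b n * (1 - 0) ^ n)"
    by (intro tendsto_intros LIMSEQ_Suc[OF lim_1_over_n])
  then have "(\<Sum>n=1..N. b n * (1 - 0) ^ n) \<le> 1"
    by (rule LIMSEQ_le_const2) (use le in auto)
  then show ?thesis by simp
qed

text \<open>The full sum of the \<open>b n\<close> serves as \<open>B\<close>: it is at most 1 and,
  without maximality, different from 1.\<close>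

lemma not_maximal_bound:
  assumes "\<not> maximal_cnp b"
  obtains B where "0 \<le> B" "B < 1" "\<And>N. (\<Sum>n=1..N. b n) \<le> B"
proof -
  have shift: "(\<Sum>n=1..N. b n) = (\<Sum>n<N. b (Suc n))" for N
    by (rule sum.reindex_bij_witness[of _ Suc "\<lambda>n. n - 1"]) auto
  have nonneg: "0 \<le> b (Suc n)" for n by (simp add: b_nonneg)
  have le: "(\<Sum>n<N. b (Suc n)) \<le> 1" for N using b_partial_sum_le_1[of N] by (simp only: shift)
  have summ: "summable (\<lambda>n. b (Suc n))"
    by (rule summableI_nonneg_bounded[OF nonneg le])
  have "(\<Sum>n. b (Suc n)) \<noteq> 1" using assms summ by (auto simp: maximal_cnp_def sums_iff)
  moreover have "(\<Sum>n. b (Suc n)) \<le> 1" by (rule suminf_le_const[OF summ le])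
  ultimately have lt: "(\<Sum>n. b (Suc n)) < 1" by simp
  have ge: "0 \<le> (\<Sum>n. b (Suc n))" by (rule suminf_nonneg[OF summ nonneg])
  have "(\<Sum>n=1..N. b n) \<le> (\<Sum>n. b (Suc n))" for N
    unfolding shift using nonneg by (intro sum_le_suminf[OF summ]) auto
  from that[OF ge lt this] show thesis .
qed


section \<open>Multiplication by monomials, its adjoint, and the adjoint of the truncated
  row\<close>

lemma ball_monom_Cons: "ball_monom (i # p) = ball_monom [i] * ball_monom p"
  by (auto simp: ball_monom_def fun_eq_iff)

lemma ball_monom_Nil_mult: "f \<in> H \<Longrightarrow> ball_monom [] * f = f"
  by (auto simp: ball_monom_def fun_eq_iff outside)

text \<open>Induction on the word. A single coordinate is bounded since \<open>sqrt (b 1)\<close>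
  times it is a row with one entry. Mere boundedness suffices for the existence of adjoints.\<close>

lemma ball_monom_bounded: "\<exists>C\<ge>0. \<forall>h\<in>H. ball_monom p * h \<in> H \<and> nrm (ball_monom p * h) \<le> C * nrm h"
proof (induction p)
  case Nil
  show ?case by (intro exI[of _ 1]) (auto simp: ball_monom_Nil_mult)
next
  case (Cons i p)
  then obtain C where C: "C \<ge> 0" "\<And>h. h \<in> H \<Longrightarrow> ball_monom p * h \<in> H"
      "\<And>h. h \<in> H \<Longrightarrow> nrm (ball_monom p * h) \<le> C * nrm h" by blast
  have row: "cscale (sqrt (b 1)) (ball_monom [i] * h) \<in> H \<and> nrm (cscale (sqrt (b 1)) (ball_monom [i] * h)) \<le> nrm h"
    if "h \<in> H" for h
    using row_contraction[of "{[i]}" 1 "\<lambda>_. h"] that by (auto simp: words_def)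
  have coord: "ball_monom [i] * h \<in> H \<and> nrm (ball_monom [i] * h) \<le> nrm h / sqrt (b 1)" if h: "h \<in> H" for h
  proof -
    let ?s = "complex_of_real (sqrt (b 1))"
    have eq: "ball_monom [i] * h = cscale (inverse ?s) (cscale ?s (ball_monom [i] * h))"
      using b_1_pos by (simp add: cscale_def fun_eq_iff)
    have "ball_monom [i] * h \<in> H" by (subst eq, rule scale_mem) (use row[OF h] in simp)
    moreover from this have "sqrt (b 1) * nrm (ball_monom [i] * h) \<le> nrm h"
      using row[OF h] b_1_pos by simp
    ultimately show ?thesis using b_1_pos by (simp add: field_simps)
  qed
  have "ball_monom (i # p) * h \<in> H \<and> nrm (ball_monom (i # p) * h) \<le> (C / sqrt (b 1)) * nrm h" if h: "h \<in> H" for h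
  proof -
    have "ball_monom (i # p) * h = ball_monom [i] * (ball_monom p * h)" by (simp add: ball_monom_Cons[of i p] mult.assoc)
    moreover have "nrm (ball_monom p * h) / sqrt (b 1) \<le> C * nrm h / sqrt (b 1)"
      using C(3)[OF h] b_1_pos by (simp add: divide_right_mono)
    ultimately show ?thesis using coord[OF C(2)[OF h]] by auto
  qed
  moreover have "C / sqrt (b 1) \<ge> 0" using C b_1_pos by simp
  ultimately show ?case by blast
qed

lemma ball_monom_mem [simp]: "h \<in> H \<Longrightarrow> ball_monom p * h \<in> H"
  using ball_monom_bounded by blast

definition adj :: "'d list \<Rightarrow> (complex ^ 'd) cfun \<Rightarrow> (complex ^ 'd) cfun" where
  "adj p f = (SOME g. g \<in> H \<and> (\<forall>h\<in>H. ip h g = ip (ball_monom p * h) f))"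

lemma adj:
  assumes f: "f \<in> H"
  shows adj_mem: "adj p f \<in> H" and ip_adj: "h \<in> H \<Longrightarrow> ip h (adj p f) = ip (ball_monom p * h) f"
proof -
  obtain C where C: "C \<ge> 0" "\<And>h. h \<in> H \<Longrightarrow> nrm (ball_monom p * h) \<le> C * nrm h"
    using ball_monom_bounded by blast
  have dist: "ball_monom p * (h + h') = ball_monom p * h + ball_monom p * h'" for h h'
    by (simp add: distrib_left)
  have scal: "ball_monom p * cscale c h = cscale c (ball_monom p * h)" for c h
    by (simp add: cscale_def fun_eq_iff)
  have bound: "cmod (ip (ball_monom p * h) f) \<le> (C * nrm f) * nrm h" if "h \<in> H" for h
  proof -
    have "cmod (ip (ball_monom p * h) f) \<le> nrm (ball_monom p * h) * nrm f"
      using that f by (intro cauchy_schwarz) auto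
    also have "\<dots> \<le> (C * nrm h) * nrm f"
      using C that f by (intro mult_right_mono) auto
    finally show ?thesis by (simp add: mult_ac)
  qed
  obtain g where "g \<in> norm_closure_on H ip H" "\<And>h. h \<in> H \<Longrightarrow> ip h g = ip (ball_monom p * h) f"
    by (rule riesz_on[of H "C * nrm f" "\<lambda>h. ip (ball_monom p * h) f"])
      (use C f bound in \<open>auto simp: dist scal subspace\<close>)
  then have "\<exists>g. g \<in> H \<and> (\<forall>h\<in>H. ip h g = ip (ball_monom p * h) f)"
    by (auto simp: norm_closure_on_def)
  from someI_ex[OF this] show "adj p f \<in> H" "h \<in> H \<Longrightarrow> ip h (adj p f) = ip (ball_monom p * h) f"
    unfolding adj_def by auto
qed

lemma adj_eqI:
  assumes "f \<in> H" "g \<in> H" "\<And>h. h \<in> H \<Longrightarrow> ip h g = ip (ball_monom p * h) f"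
  shows "adj p f = g"
  using assms by (intro ip_eqD) (auto simp: adj_mem ip_adj)

lemma adj_add: "f \<in> H \<Longrightarrow> g \<in> H \<Longrightarrow> adj p (f + g) = adj p f + adj p g"
  by (intro adj_eqI) (auto simp: adj_mem ip_adj)

text \<open>Kernel functions are eigenvectors of adjoints of multipliers, with conjugated values as
  eigenvalues.\<close>

lemma adj_comb:
  assumes S: "S \<subseteq> ball 0 1"
  shows "adj p (comb S c) = shift_comb p S c"
proof (intro adj_eqI)
  fix h assume h: "h \<in> H"
  have "ip (shift_comb p S c) h = ip (comb S c) (ball_monom p * h)"
    using S h by (simp add: shift_comb_def ip_comb) (auto simp: ball_monom_def mult_ac intro!: sum.cong)
  then show "ip h (shift_comb p S c) = ip (ball_monom p * h) (comb S c)"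
    using S h ip_cnj[of h "shift_comb p S c"] ip_cnj[of "ball_monom p * h" "comb S c"]
    by (metis comb_mem complex_cnj_cnj ball_monom_mem shift_comb_mem)
qed (use S in \<open>auto simp: comb_mem shift_comb_mem\<close>)

text \<open>The norm of the image of \<open>f\<close> under the adjoint of the truncated
  row.\<close>

definition row_norm :: "nat \<Rightarrow> (complex ^ 'd) cfun \<Rightarrow> real" where
  "row_norm N f = L2_set (\<lambda>p. sqrt (b (length p)) * nrm (adj p f)) (words N)"

lemma row_norm_nonneg: "0 \<le> row_norm N f"
  by (simp add: row_norm_def L2_set_nonneg)

lemma row_norm_sq: "(row_norm N f)\<^sup>2 = (\<Sum>p\<in>words N. b (length p) * (nrm (adj p f))\<^sup>2)"
  unfolding row_norm_def L2_set_def
  by (subst real_sqrt_pow2) (auto simp: power_mult_distrib b_words_nonneg sum_nonneg intro!: sum.cong)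

text \<open>The truncated row is applied to its own adjoint at \<open>f\<close>, so the weight
  \<open>sqrt b\<close> occurs once for each of the two.\<close>

lemma row_test_vector:
  assumes f: "f \<in> H"
  shows "ip (\<Sum>p\<in>words N. cscale (sqrt (b (length p))) (ball_monom p * cscale (sqrt (b (length p))) (adj p f))) f
      = complex_of_real ((row_norm N f)\<^sup>2)"
proof -
  have scal: "ball_monom p * cscale c h = cscale c (ball_monom p * h)" for p c h
    by (simp add: cscale_def fun_eq_iff)
  have "ip (\<Sum>p\<in>words N. cscale (sqrt (b (length p))) (ball_monom p * cscale (sqrt (b (length p))) (adj p f))) f
      = (\<Sum>p\<in>words N. of_real (sqrt (b (length p)) * sqrt (b (length p))) * ip (ball_monom p * adj p f) f)"
    using f by (simp add: sum_left scal adj_mem mult.assoc del: real_sqrt_mult_self)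
  also have "\<dots> = (\<Sum>p\<in>words N. of_real (b (length p) * (nrm (adj p f))\<^sup>2))"
    using f by (intro sum.cong) (auto simp: adj_mem ip_self simp flip: ip_adj dest!: b_words_nonneg)
  finally show ?thesis by (simp add: row_norm_sq)
qed

text \<open>The adjoint of a contraction is a contraction: \<open>row_test_vector\<close> and
  Cauchy-Schwarz give \<open>(row_norm N f)\<^sup>2 \<le> row_norm N f * nrm f\<close>.\<close>

lemma row_norm_le:
  assumes f: "f \<in> H"
  shows "row_norm N f \<le> nrm f"
proof -
  let ?h = "\<lambda>p. cscale (sqrt (b (length p))) (adj p f)"
  let ?g = "\<Sum>p\<in>words N. cscale (sqrt (b (length p))) (ball_monom p * ?h p)"
  have mem: "?h p \<in> H" for p using f by (simp add: adj_mem)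
  have g: "?g \<in> H" "nrm ?g \<le> sqrt (\<Sum>p\<in>words N. (nrm (?h p))\<^sup>2)"
    using row_contraction[of "words N" N ?h] mem by auto
  have "sqrt (\<Sum>p\<in>words N. (nrm (?h p))\<^sup>2) = row_norm N f"
    unfolding row_norm_def L2_set_def using f
    by (intro arg_cong[of _ _ sqrt] sum.cong) (auto simp: adj_mem dest!: b_words_nonneg)
  with g have "nrm ?g \<le> row_norm N f" by simp
  have "(row_norm N f)\<^sup>2 = cmod (ip ?g f)"
    unfolding row_test_vector[OF f] by (simp add: norm_power)
  also have "\<dots> \<le> nrm ?g * nrm f" using g f by (intro cauchy_schwarz)
  also have "\<dots> \<le> row_norm N f * nrm f"
    using \<open>nrm ?g \<le> row_norm N f\<close> f by (intro mult_right_mono) auto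
  finally show ?thesis
    using row_norm_nonneg[of N f] f
    by (cases "row_norm N f = 0") (auto simp: power2_eq_square mult_le_cancel_left)
qed

lemma row_norm_triangle:
  assumes "f \<in> H" "g \<in> H"
  shows "row_norm N (f + g) \<le> row_norm N f + row_norm N g"
proof -
  have "row_norm N (f + g) \<le> L2_set (\<lambda>p. sqrt (b (length p)) * nrm (adj p f) + sqrt (b (length p)) * nrm (adj p g)) (words N)"
    unfolding row_norm_def
  proof (intro L2_set_mono)
    fix p :: "'d list" assume "p \<in> words N"
    then have "sqrt (b (length p)) * nrm (adj p f + adj p g) \<le> sqrt (b (length p)) * (nrm (adj p f) + nrm (adj p g))"
      using assms by (intro mult_left_mono triangle) (auto simp: adj_mem b_words_nonneg)
    then show "sqrt (b (length p)) * nrm (adj p (f + g)) \<le> sqrt (b (length p)) * nrm (adj p f) + sqrt (b (length p)) * nrm (adj p g)"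
      using assms by (simp add: adj_add distrib_left)
  qed (use assms in \<open>auto simp: adj_mem b_words_nonneg\<close>)
  also have "\<dots> \<le> row_norm N f + row_norm N g"
    unfolding row_norm_def by (rule L2_set_triangle_ineq)
  finally show ?thesis .
qed

lemma nrm_K_0: "nrm (K 0) = 1"
proof -
  have "K 0 \<in> H" by (simp add: K_mem)
  moreover have "ip (K 0) (K 0) = 1"
    using reproducing[of 0 "K 0"] \<open>K 0 \<in> H\<close> by (simp add: K_def ui_kernel_0_left a_0)
  ultimately show ?thesis by (simp add: ipnorm_def)
qed

text \<open>\<open>f\<close> is replaced by a kernel combination \<open>u\<close>, for which
  \<open>shift_comb_tendsto\<close> gives the limit of the row norms. The defect
  \<open>cmod (u 0)\<close> is small because \<open>f 0 = 0\<close>, and contractivity carries the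
  estimate back to \<open>f\<close>.\<close>

lemma row_norm_lower:
  assumes f: "f \<in> H" and f0: "f 0 = 0" and e: "e > 0"
  shows "\<exists>N. row_norm N f \<ge> nrm f - e"
proof -
  \<comment> \<open>One \<open>r\<close> is lost between \<open>nrm f\<close> and
    \<open>nrm u\<close>, two in the truncation, and one in returning from \<open>u\<close> to
    \<open>f\<close>.\<close>
  define r where "r = e / 4"
  have r: "r > 0" using e by (simp add: r_def)
  obtain S c where S: "S \<subseteq> ball 0 1" and close: "nrm (f - comb S c) < r"
    by (rule comb_dense[OF f r])
  define u where "u = comb S c"
  have u: "u \<in> H" using S by (simp add: u_def comb_mem)
  have fu: "nrm (u - f) < r" using close nrm_minus_commute[OF u f] by (simp add: u_def)
  have u0: "cmod (u 0) \<le> r"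
  proof -
    have "cmod (u 0) = cmod (ip (u - f) (K 0))" using u f f0 by (subst reproducing) auto
    also have "\<dots> \<le> nrm (u - f) * nrm (K 0)" using u f K_mem by (intro cauchy_schwarz) auto
    finally show ?thesis using fu by (simp add: nrm_K_0)
  qed
  have nu: "nrm f - r \<le> nrm u"
    using triangle_diff[OF f u] close by (simp add: u_def)
  \<comment> \<open>If \<open>nrm u < 2 * r\<close> the bound is negative and trivial; otherwise
    squares may be compared, and the gap \<open>r * (4 * nrm u - 5 * r)\<close> is positive.\<close>
  have "\<exists>N. row_norm N u > nrm u - 2 * r"
  proof (cases "nrm u < 2 * r")
    case True
    then have "row_norm 0 u > nrm u - 2 * r" using row_norm_nonneg[of 0 u] by simp
    then show ?thesis by blast
  next
    case False
    have lim: "(\<lambda>N. (row_norm N u)\<^sup>2) \<longlonglongrightarrow> (nrm u)\<^sup>2 - (cmod (u 0))\<^sup>2"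
      unfolding row_norm_sq using shift_comb_tendsto[OF S, of c] S by (simp add: u_def adj_comb)
    have "(nrm u - 2 * r)\<^sup>2 < (nrm u)\<^sup>2 - r\<^sup>2"
    proof -
      have "r * (4 * nrm u - 5 * r) > 0" using False r by (intro mult_pos_pos) auto
      then show ?thesis by (simp add: power2_eq_square algebra_simps)
    qed
    also have "\<dots> \<le> (nrm u)\<^sup>2 - (cmod (u 0))\<^sup>2" using u0 by (simp add: power_mono)
    finally have "\<forall>\<^sub>F N in sequentially. (nrm u - 2 * r)\<^sup>2 < (row_norm N u)\<^sup>2"
      by (rule order_tendstoD(1)[OF lim])
    then obtain N where "(nrm u - 2 * r)\<^sup>2 < (row_norm N u)\<^sup>2" by (auto simp: eventually_sequentially)
    then have "nrm u - 2 * r < row_norm N u"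
      by (rule power2_less_imp_less) (rule row_norm_nonneg)
    then show ?thesis by blast
  qed
  then obtain N where N: "row_norm N u > nrm u - 2 * r" ..
  have "row_norm N u \<le> row_norm N f + row_norm N (u - f)"
    using row_norm_triangle[of f "u - f" N] f u by simp
  also have "row_norm N (u - f) \<le> nrm (u - f)" using f u by (intro row_norm_le) simp
  finally have "row_norm N f \<ge> nrm f - e" using N fu nu by (simp add: r_def)
  then show ?thesis by blast
qed

end

section \<open>Scalar rows as square matrices, and monomials as polynomials\<close>

lemma scalar_row_norm:
  assumes n: "n \<ge> 1"
  shows "scalar_matrix_norm n (\<lambda>i j. if i = 0 then r j else 0) = sqrt (\<Sum>j<n. (cmod (r j))\<^sup>2)"
proof -
  let ?L = "sqrt (\<Sum>j<n. (cmod (r j))\<^sup>2)"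
  have row_value: "sqrt (\<Sum>i<n. (cmod (\<Sum>j<n. (if i = 0 then r j else 0) * v j))\<^sup>2) = cmod (\<Sum>j<n. r j * v j)" for v
  proof -
    have "(\<Sum>i<n. (cmod (\<Sum>j<n. (if i = 0 then r j else 0) * v j))\<^sup>2)
        = (\<Sum>i<n. if i = 0 then (cmod (\<Sum>j<n. r j * v j))\<^sup>2 else 0)"
      by (rule sum.cong) auto
    then show ?thesis using n by simp
  qed
  let ?V = "{v. (\<Sum>j<n. (cmod (v j))\<^sup>2) \<le> 1}"
  have upper: "cmod (\<Sum>j<n. r j * v j) \<le> ?L" if "v \<in> ?V" for v
  proof -
    have "cmod (\<Sum>j<n. r j * v j) \<le> (\<Sum>j<n. \<bar>cmod (r j)\<bar> * \<bar>cmod (v j)\<bar>)"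
      by (intro sum_norm_le) (simp add: norm_mult)
    also have "\<dots> \<le> L2_set (\<lambda>j. cmod (r j)) {..<n} * L2_set (\<lambda>j. cmod (v j)) {..<n}"
      by (rule L2_set_mult_ineq)
    also have "\<dots> \<le> L2_set (\<lambda>j. cmod (r j)) {..<n} * 1"
      using that by (intro mult_left_mono) (auto simp: L2_set_def sum_nonneg)
    finally show ?thesis by (simp add: L2_set_def)
  qed
  have "\<exists>v\<in>?V. ?L \<le> cmod (\<Sum>j<n. r j * v j)"
  proof (cases "?L = 0")
    case True
    then show ?thesis by (intro bexI[of _ "\<lambda>_. 0"]) auto
  next
    case False
    define L where "L = ?L"
    have L: "L \<ge> 0" "L \<noteq> 0" using False by (auto simp: L_def sum_nonneg)
    have L2: "(\<Sum>j<n. (cmod (r j))\<^sup>2) = L\<^sup>2" by (simp add: L_def sum_nonneg)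
    \<comment> \<open>The normalised conjugate of the row, at which Cauchy-Schwarz is an
      equality.\<close>
    define v where "v = (\<lambda>j. cnj (r j) / complex_of_real L)"
    have "(\<Sum>j<n. (cmod (v j))\<^sup>2) = (\<Sum>j<n. (cmod (r j))\<^sup>2) / L\<^sup>2"
      by (simp add: v_def norm_divide power_divide sum_divide_distrib)
    then have "v \<in> ?V" using L by (simp add: L2)
    have "(\<Sum>j<n. r j * v j) = complex_of_real ((\<Sum>j<n. (cmod (r j))\<^sup>2) / L)"
      unfolding of_real_divide of_real_sum complex_norm_square by (simp add: v_def sum_divide_distrib)
    also have "\<dots> = complex_of_real L"
      unfolding L2 using L by (simp add: power2_eq_square)
    finally have "cmod (\<Sum>j<n. r j * v j) = ?L" using L by (simp add: L_def)
    with \<open>v \<in> ?V\<close> show ?thesis by (intro bexI[of _ v]) auto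
  qed
  then obtain v where v: "v \<in> ?V" "?L \<le> cmod (\<Sum>j<n. r j * v j)" by blast
  show ?thesis
    unfolding scalar_matrix_norm_def row_value
  proof (rule antisym)
    show "(SUP v\<in>?V. cmod (\<Sum>j<n. r j * v j)) \<le> ?L"
      using upper v(1) by (intro cSUP_least) auto
    show "?L \<le> (SUP v\<in>?V. cmod (\<Sum>j<n. r j * v j))"
      using upper v by (intro cSUP_upper2[of _ _ v]) (auto intro!: bdd_aboveI2)
  qed
qed

lemma op_norm_0:
  assumes "cfun.subspace K" "ip 0 0 = 0"
  shows "op_norm K ip 0 = 0"
proof -
  have "0 \<in> {f \<in> K. ipnorm ip f \<le> 1}"
    using cfun.subspace_0[OF assms(1)] assms(2) by (simp add: ipnorm_def)
  then have "{f \<in> K. ipnorm ip f \<le> 1} \<noteq> {}" by blast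
  then show ?thesis by (simp add: op_norm_def ipnorm_def assms(2))
qed

text \<open>The letter counts of a word form its multi-index; this links words with the monomials
  that span \<open>ball_polynomials\<close>.\<close>

lemma word_monom_count:
  fixes z :: "complex ^ 'd"
  shows "(\<Prod>i\<in>UNIV. z $ i ^ count_list p i) = word_monom p z"
proof (induction p)
  case (Cons i p)
  have "(\<Prod>j\<in>UNIV. z $ j ^ count_list (i # p) j) = (\<Prod>j\<in>UNIV. (if j = i then z $ j else 1) * z $ j ^ count_list p j)"
    by (rule prod.cong) auto
  then show ?case by (simp add: prod.distrib Cons.IH)
qed simp

lemma ball_monom_polynomial: "cscale c (ball_monom p) \<in> ball_polynomials"
proof -
  have "ball_monom p = (\<lambda>z. if z \<in> ball 0 1 then \<Prod>i\<in>UNIV. z $ i ^ count_list p i else 0)"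
    by (simp add: ball_monom_def word_monom_count fun_eq_iff)
  then have "ball_monom p \<in> range (\<lambda>\<alpha> :: 'a \<Rightarrow> nat. \<lambda>z. if z \<in> ball 0 1 then \<Prod>i\<in>UNIV. z $ i ^ \<alpha> i else 0)"
    by (rule range_eqI[of _ _ "count_list p"])
  then show ?thesis
    unfolding ball_polynomials_def by (intro cfun.span_scale cfun.span_base)
qed

subsection \<open>Quotients by weak-* closed ideals\<close>

locale cnp_ideal = cnp H ip a b
  for H :: "(complex ^ 'd) cfun set" and ip a b +
  fixes \<aa> :: "(complex ^ 'd) cfun set"
  assumes ideal: "weak_star_closed_ideal (ball 0 1) H ip \<aa>"
begin

abbreviation Q where "Q \<equiv> quotient_space H ip \<aa>"

lemma ideal_mult: "\<phi> \<in> \<aa> \<Longrightarrow> f \<in> H \<Longrightarrow> \<phi> * f \<in> H"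
  using ideal unfolding weak_star_closed_ideal_def multipliers_def by blast

text \<open>Orthogonality to the products passes to their span by linearity and to its closure by
  Cauchy-Schwarz.\<close>

lemma quotient_iff: "f \<in> Q \<longleftrightarrow> f \<in> H \<and> (\<forall>\<phi>\<in>\<aa>. \<forall>h\<in>H. ip f (\<phi> * h) = 0)"
proof
  assume f: "f \<in> Q"
  have "\<phi> * h \<in> ideal_space H ip \<aa>" if "\<phi> \<in> \<aa>" "h \<in> H" for \<phi> h
  proof -
    have "\<phi> * h = mult_op H \<phi> h" using that by (simp add: mult_op_def)
    then have span: "\<phi> * h \<in> cfun.span {mult_op H \<phi> f | \<phi> f. \<phi> \<in> \<aa> \<and> f \<in> H}"
      using that by (intro cfun.span_base) blast
    show ?thesis
      unfolding ideal_space_def norm_closure_on_def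
      by (intro CollectI conjI allI impI bexI[OF _ span] ideal_mult that) simp
  qed
  then show "f \<in> H \<and> (\<forall>\<phi>\<in>\<aa>. \<forall>h\<in>H. ip f (\<phi> * h) = 0)"
    using f unfolding quotient_space_def orth_compl_def by blast
next
  assume f: "f \<in> H \<and> (\<forall>\<phi>\<in>\<aa>. \<forall>h\<in>H. ip f (\<phi> * h) = 0)"
  have sub: "cfun.subspace {g \<in> H. ip f g = 0}"
    using f by (auto simp: cfun.subspace_def)
  have "cfun.span {mult_op H \<phi> f | \<phi> f. \<phi> \<in> \<aa> \<and> f \<in> H} \<subseteq> {g \<in> H. ip f g = 0}"
    using f ideal_mult by (intro cfun.span_minimal[OF _ sub]) (auto simp: mult_op_def)
  then have span: "g \<in> H \<and> ip f g = 0" if "g \<in> cfun.span {mult_op H \<phi> f | \<phi> f. \<phi> \<in> \<aa> \<and> f \<in> H}" for g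
    using that by blast
  have "ip f x = 0" if x: "x \<in> ideal_space H ip \<aa>" for x
  proof -
    have xH: "x \<in> H" using x by (simp add: ideal_space_def norm_closure_on_def)
    have "cmod (ip f x) \<le> 0 + e" if "e > 0" for e
    proof -
      \<comment> \<open>The added 1 keeps the quotient defined when
        \<open>nrm f = 0\<close>.\<close>
      define e' where "e' = e / (nrm f + 1)"
      have nf: "0 \<le> nrm f" using f by simp
      then have "e' > 0" using that by (simp add: e'_def)
      then obtain g where g: "g \<in> H" "ip f g = 0" "nrm (x - g) < e'"
        using x span unfolding ideal_space_def norm_closure_on_def by blast
      have "cmod (ip f x) = cmod (ip f (x - g))" using f g xH by simp
      also have "\<dots> \<le> nrm f * nrm (x - g)" using f g xH by (intro cauchy_schwarz) auto
      also have "\<dots> \<le> (nrm f + 1) * e'" using g nf xH by (intro mult_mono) auto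
      finally show ?thesis using nf by (simp add: e'_def)
    qed
    then have "cmod (ip f x) \<le> 0" by (rule field_le_epsilon)
    then show ?thesis by simp
  qed
  then show "f \<in> Q" using f unfolding quotient_space_def orth_compl_def by blast
qed

lemma quotient_subset: "f \<in> Q \<Longrightarrow> f \<in> H"
  by (simp add: quotient_iff)

lemma quotient_subspace: "cfun.subspace Q"
  unfolding cfun.subspace_def by (auto simp: quotient_iff ideal_mult)

text \<open>Needed because \<open>riesz_on\<close> places its vector only in the closure of the
  subspace.\<close>

lemma quotient_closed: "norm_closure_on H ip Q \<subseteq> Q"
proof
  fix x assume x: "x \<in> norm_closure_on H ip Q"
  have xH: "x \<in> H" using x by (simp add: norm_closure_on_def)
  have "ip x (\<phi> * h) = 0" if \<phi>: "\<phi> \<in> \<aa>" "h \<in> H" for \<phi> h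
  proof -
    have y: "\<phi> * h \<in> H" by (rule ideal_mult[OF \<phi>])
    have "cmod (ip x (\<phi> * h)) \<le> 0 + e" if "e > 0" for e
    proof -
      define e' where "e' = e / (nrm (\<phi> * h) + 1)"
      have nf: "0 \<le> nrm (\<phi> * h)" using y by simp
      then have "e' > 0" using that by (simp add: e'_def)
      then obtain g where g: "g \<in> Q" "nrm (x - g) < e'"
        using x unfolding norm_closure_on_def by blast
      have "ip g (\<phi> * h) = 0" using g(1) \<phi> by (simp add: quotient_iff)
      then have "cmod (ip x (\<phi> * h)) = cmod (ip (x - g) (\<phi> * h))" using y quotient_subset[OF g(1)] xH by simp
      also have "\<dots> \<le> nrm (x - g) * nrm (\<phi> * h)" using y quotient_subset[OF g(1)] xH by (intro cauchy_schwarz) auto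
      also have "\<dots> \<le> e' * (nrm (\<phi> * h) + 1)" using g nf \<open>e' > 0\<close> by (intro mult_mono) auto
      finally show ?thesis using nf by (simp add: e'_def)
    qed
    then have "cmod (ip x (\<phi> * h)) \<le> 0" by (rule field_le_epsilon)
    then show ?thesis by simp
  qed
  then show "x \<in> Q" using xH by (simp add: quotient_iff)
qed

section \<open>The orthogonal projection onto the quotient space\<close>

definition proj where "proj = orth_proj Q ip"

lemma proj_unique:
  assumes x: "x \<in> H" and g: "g \<in> Q" and eq: "\<And>h. h \<in> Q \<Longrightarrow> ip g h = ip x h"
  shows "proj x = g"
  unfolding proj_def orth_proj_def
proof (rule the_equality)
  show "g \<in> Q \<and> (\<forall>h\<in>Q. ip (x - g) h = 0)"
    using assms by (simp add: quotient_subset)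
next
  fix g' assume g': "g' \<in> Q \<and> (\<forall>h\<in>Q. ip (x - g') h = 0)"
  have d: "g' - g \<in> Q" using g g' by (simp add: cfun.subspace_diff[OF quotient_subspace])
  have "ip (x - g') (g' - g) = 0" using g' d by blast
  then have "ip g' (g' - g) = ip g (g' - g)"
    using eq[OF d] g g' x d by (simp add: quotient_subset del: diff_right)
  then have "ip (g' - g) (g' - g) = 0"
    using g g' by (simp add: quotient_subset del: diff_right)
  then show "g' = g" using ip_zeroD[OF quotient_subset[OF d]] by simp
qed

text \<open>The projection of \<open>x\<close> is the Riesz vector of pairing with \<open>x\<close>
  restricted to \<open>Q\<close>; closedness puts this vector in \<open>Q\<close>.\<close>

lemma proj:
  assumes x: "x \<in> H"
  shows proj_mem: "proj x \<in> Q" and ip_proj: "h \<in> Q \<Longrightarrow> ip (proj x) h = ip x h"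
proof -
  have sub: "Q \<subseteq> H" using quotient_subset by blast
  have nx: "0 \<le> nrm x" using x by simp
  have add: "ip (f + g) x = ip f x + ip g x" if "f \<in> Q" "g \<in> Q" for f g
    using that x by (simp add: quotient_subset)
  have scale: "ip (cscale c f) x = c * ip f x" if "f \<in> Q" for c f
    using that x by (simp add: quotient_subset)
  have bound: "cmod (ip f x) \<le> nrm x * nrm f" if "f \<in> Q" for f
    using cauchy_schwarz[OF quotient_subset[OF that] x] by (simp add: mult.commute)
  obtain g where g: "g \<in> norm_closure_on H ip Q" and repr: "\<And>f. f \<in> Q \<Longrightarrow> ip f g = ip f x"
    by (rule riesz_on[of Q "nrm x" "\<lambda>f. ip f x", OF quotient_subspace sub nx add scale bound])
      (assumption | rule that)+
  have gQ: "g \<in> Q" using g quotient_closed by blast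
  have eq: "ip g h = ip x h" if "h \<in> Q" for h
    using repr[OF that] ip_cnj[of h g] ip_cnj[of h x] that gQ x by (simp add: quotient_subset)
  have "proj x = g" by (rule proj_unique[OF x gQ eq])
  with gQ eq show "proj x \<in> Q" "h \<in> Q \<Longrightarrow> ip (proj x) h = ip x h" by auto
qed

lemma proj_add: "x \<in> H \<Longrightarrow> y \<in> H \<Longrightarrow> proj (x + y) = proj x + proj y"
  by (intro proj_unique)
    (auto simp: proj_mem ip_proj quotient_subset intro!: cfun.subspace_add[OF quotient_subspace])

lemma proj_scale: "x \<in> H \<Longrightarrow> proj (cscale c x) = cscale c (proj x)"
  by (intro proj_unique)
    (auto simp: proj_mem ip_proj quotient_subset intro!: cfun.subspace_scale[OF quotient_subspace])

lemma proj_sum: "(\<And>i. i \<in> I \<Longrightarrow> f i \<in> H) \<Longrightarrow> proj (\<Sum>i\<in>I. f i) = (\<Sum>i\<in>I. proj (f i))"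
proof (induction I rule: infinite_finite_induct)
  case (insert i I)
  have "proj (f i + sum f I) = proj (f i) + proj (sum f I)"
    using insert.prems by (intro proj_add sum_mem) blast+
  also have "proj (sum f I) = (\<Sum>i\<in>I. proj (f i))"
    using insert.prems by (intro insert.IH) blast
  finally show ?case unfolding sum.insert[OF insert.hyps] .
qed (auto intro!: proj_unique simp: cfun.subspace_0[OF quotient_subspace])

lemma proj_id: "f \<in> Q \<Longrightarrow> proj f = f"
  by (intro proj_unique) (auto simp: quotient_subset)

lemma nrm_proj_le: "x \<in> H \<Longrightarrow> nrm (proj x) \<le> nrm x"
proof -
  assume x: "x \<in> H"
  note P = proj_mem[OF x] quotient_subset[OF proj_mem[OF x]]
  have "(nrm (proj x))\<^sup>2 = Re (ip x (proj x))" using ip_proj[OF x P(1)] P(2) by (simp add: nrm_sq)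
  also have "\<dots> \<le> cmod (ip x (proj x))" by (rule complex_Re_le_cmod)
  also have "\<dots> \<le> nrm x * nrm (proj x)" by (rule cauchy_schwarz[OF x P(2)])
  finally show ?thesis using nrm_nonneg[OF x] nrm_nonneg[OF P(2)]
    by (cases "nrm (proj x) = 0") (auto simp: power2_eq_square mult_le_cancel_right)
qed

section \<open>Compressed monomials and their values under characters\<close>

definition Z where "Z c p = compressed_mult H ip \<aa> (cscale c (ball_monom p))"

lemma cscale_ball_monom_mult: "cscale c (ball_monom p) * f = cscale c (ball_monom p * f)"
  by (simp add: cscale_def fun_eq_iff)

lemma Z_apply: "f \<in> Q \<Longrightarrow> Z c p f = cscale c (proj (ball_monom p * f))"
  by (simp add: Z_def compressed_mult_def mult_op_def quotient_subset cscale_ball_monom_mult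
      proj_scale flip: proj_def)

lemma Z_outside: "f \<notin> Q \<Longrightarrow> Z c p f = 0"
  by (simp add: Z_def compressed_mult_def)

lemma Z_bounded: "Z c p \<in> bounded_ops Q ip"
  unfolding bounded_ops_def
proof (safe, goal_cases)
  case (1 f)
  then show ?case
    by (simp add: Z_apply cfun.subspace_scale[OF quotient_subspace] proj_mem quotient_subset)
next
  case (2 f g)
  then show ?case
    by (simp add: Z_apply cfun.subspace_add[OF quotient_subspace] proj_add quotient_subset
        distrib_left cfun.scale_right_distrib)
next
  case (3 r f)
  have "ball_monom p * cscale r f = cscale r (ball_monom p * f)" by (simp add: cscale_def fun_eq_iff)
  with 3 show ?case
    by (simp add: Z_apply cfun.subspace_scale[OF quotient_subspace] proj_scale quotient_subset mult.commute[of r c])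
next
  case 4
  obtain C where C: "\<And>h. h \<in> H \<Longrightarrow> nrm (ball_monom p * h) \<le> C * nrm h"
    using ball_monom_bounded by blast
  have "nrm (Z c p f) \<le> (cmod c * C) * nrm f" if "f \<in> Q" for f
  proof -
    have f: "f \<in> H" using that by (rule quotient_subset)
    have "nrm (Z c p f) = cmod c * nrm (proj (ball_monom p * f))"
      using that f by (simp add: Z_apply quotient_subset proj_mem)
    also have "\<dots> \<le> cmod c * (C * nrm f)"
      using C[OF f] nrm_proj_le[of "ball_monom p * f"] f by (intro mult_left_mono) auto
    finally show ?thesis by (simp add: mult_ac)
  qed
  then show ?case by blast
next
  case (5 f)
  then show ?case by (simp add: Z_outside)
qed

lemma Z_mem: "Z c p \<in> quotient_algebra H ip \<aa>"
proof -
  have "cscale c (ball_monom p) \<in> multipliers (ball 0 1) H"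
    by (auto simp: multipliers_def cscale_ball_monom_mult) (simp add: cscale_def ball_monom_def)
  moreover have "op_norm H ip (mult_op H (cscale c (ball_monom p)) - mult_op H (cscale c (ball_monom p))) = 0"
    using op_norm_0[of H ip] subspace by simp
  ultimately have "cscale c (ball_monom p) \<in> poly_mult_closure H ip"
    unfolding poly_mult_closure_def
    by (intro CollectI conjI allI impI bexI[OF _ ball_monom_polynomial[of c p]]) auto
  moreover have "op_norm Q ip (Z c p - compressed_mult H ip \<aa> (cscale c (ball_monom p))) = 0"
    using op_norm_0[of Q ip] quotient_subspace by (simp add: Z_def)
  ultimately show ?thesis
    unfolding quotient_algebra_def by (intro CollectI conjI allI impI bexI[of _ "cscale c (ball_monom p)"] Z_bounded) auto
qed

text \<open>Co-invariance: multiplication by a monomial commutes with the ideal and preserves its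
  products, so the adjoint preserves their orthogonal complement.\<close>

lemma adj_mem_quotient:
  assumes f: "f \<in> Q"
  shows "adj p f \<in> Q"
  unfolding quotient_iff
proof (intro conjI ballI)
  show "adj p f \<in> H" using f by (simp add: adj_mem quotient_subset)
  fix \<phi> h assume \<phi>: "\<phi> \<in> \<aa>" and h: "h \<in> H"
  have fH: "f \<in> H" using f by (rule quotient_subset)
  have "ip (\<phi> * h) (adj p f) = ip (\<phi> * (ball_monom p * h)) f"
    using fH ideal_mult[OF \<phi> h] by (simp add: ip_adj mult.left_commute)
  also have "\<dots> = 0"
    using f \<phi> h fH ip_cnj[of f "\<phi> * (ball_monom p * h)"] ideal_mult[OF \<phi>, of "ball_monom p * h"]
    by (simp add: quotient_iff)
  finally show "ip (adj p f) (\<phi> * h) = 0"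
    using ip_cnj[of "\<phi> * h" "adj p f"] ideal_mult[OF \<phi> h] fH by (simp add: adj_mem)
qed

text \<open>Compression to a co-invariant subspace is multiplicative.\<close>

lemma Z_comp: "Z 1 (i # p) = Z 1 [i] \<circ> Z 1 p"
proof
  fix f
  show "Z 1 (i # p) f = (Z 1 [i] \<circ> Z 1 p) f"
  proof (cases "f \<in> Q")
    case True
    define y where "y = ball_monom p * f"
    have y: "y \<in> H" "proj y \<in> Q" "proj y \<in> H"
      using True by (auto simp: y_def quotient_subset proj_mem)
    have "proj (ball_monom [i] * y) = proj (ball_monom [i] * proj y)"
    proof (rule proj_unique)
      fix h assume h: "h \<in> Q"
      \<comment> \<open>As \<open>adj [i] h\<close> remains in \<open>Q\<close>, pairing with it
        does not distinguish \<open>y\<close> from \<open>proj y\<close>.\<close>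
      have "ip (proj y) (adj [i] h) = ip y (adj [i] h)"
        using h y by (simp add: ip_proj adj_mem_quotient)
      then show "ip (proj (ball_monom [i] * proj y)) h = ip (ball_monom [i] * y) h"
        using h y by (simp add: ip_proj ip_adj quotient_subset)
    qed (use y in \<open>auto simp: proj_mem\<close>)
    moreover have "ball_monom (i # p) * f = ball_monom [i] * y"
      by (simp add: y_def ball_monom_Cons[of i p] mult.assoc)
    ultimately show ?thesis
      using True y by (simp add: Z_apply y_def)
  next
    case False
    have "Z 1 [i] 0 = 0"
      using cfun.subspace_0[OF quotient_subspace] proj_id[of 0] by (simp add: Z_apply)
    then show ?thesis using False by (simp add: Z_outside)
  qed
qed

lemma Z_scale: "Z c p = (\<lambda>f. cscale c (Z 1 p f))"
proof
  fix f show "Z c p f = cscale c (Z 1 p f)"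
    by (cases "f \<in> Q") (simp_all add: Z_apply Z_outside)
qed

text \<open>Multiplicativity reduces words to letters. For the empty word, \<open>Z 1 []\<close> is
  the unit of the algebra, and an element with nonzero value forces its image to be 1.\<close>

lemma character_Z_1:
  assumes "\<tau> \<in> characters (quotient_algebra H ip \<aa>)"
  shows "\<tau> (Z 1 p) = word_monom p (\<chi> i. \<tau> (Z 1 [i]))"
proof (induction p)
  case Nil
  obtain T where T: "T \<in> quotient_algebra H ip \<aa>" "\<tau> T \<noteq> 0"
    using assms unfolding characters_def by blast
  have bT: "T \<in> bounded_ops Q ip" using T(1) by (simp add: quotient_algebra_def)
  have T0: "T 0 = 0"
  proof -
    have "T (cscale 0 0) = cscale 0 (T 0)"
      using bT cfun.subspace_0[OF quotient_subspace] unfolding bounded_ops_def by blast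
    then show ?thesis by simp
  qed
  \<comment> \<open>Outside \<open>Q\<close> both sides vanish, using
    \<open>T 0 = 0\<close>.\<close>
  have "T \<circ> Z 1 [] = T"
  proof
    fix f show "(T \<circ> Z 1 []) f = T f"
    proof (cases "f \<in> Q")
      case True
      then show ?thesis by (simp add: Z_apply ball_monom_Nil_mult quotient_subset proj_id)
    next
      case False
      then have "T f = 0" using bT unfolding bounded_ops_def by blast
      with False T0 show ?thesis by (simp add: Z_outside)
    qed
  qed
  moreover have "\<tau> (T \<circ> Z 1 []) = \<tau> T * \<tau> (Z 1 [])"
    using assms T(1) Z_mem unfolding characters_def by blast
  ultimately show ?case using T(2) by simp
next
  case (Cons i p)
  have "\<tau> (Z 1 [i] \<circ> Z 1 p) = \<tau> (Z 1 [i]) * \<tau> (Z 1 p)"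
    using assms Z_mem unfolding characters_def by blast
  then show ?case by (simp only: Z_comp[of i p] Cons.IH word_monom_Cons vec_lambda_beta)
qed

lemma character_Z:
  assumes "\<tau> \<in> characters (quotient_algebra H ip \<aa>)"
  shows "\<tau> (Z c p) = c * word_monom p (\<chi> i. \<tau> (Z 1 [i]))"
proof -
  have "\<tau> (\<lambda>f. cscale c (Z 1 p f)) = c * \<tau> (Z 1 p)"
    using assms Z_mem unfolding characters_def by blast
  then show ?thesis
    unfolding Z_scale[of c p, symmetric] using character_Z_1[OF assms, of p] by (rule subst[rotated])
qed

end

subsection \<open>The truncated row operators\<close>

text \<open>Matrix norms are indexed by numbers below \<open>n\<close>, so \<open>e\<close>
  enumerates the words; \<open>n \<ge> 1\<close> provides the row with index 0.\<close>

locale cnp_row = cnp_ideal H ip a b \<aa>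
  for H :: "(complex ^ 'd) cfun set" and ip a b \<aa> +
  fixes N n :: nat and e :: "nat \<Rightarrow> 'd list"
  assumes bij: "bij_betw e {..<n} (words N)" and n: "n \<ge> 1"
begin

text \<open>The row is stored as row 0 of a square matrix. The scalar 0 makes all other entries the
  zero operator while keeping them in the algebra.\<close>

definition row_matrix :: "nat \<Rightarrow> nat \<Rightarrow> (complex ^ 'd) cop" where
  "row_matrix i j = Z (if i = 0 then complex_of_real (sqrt (b (length (e j)))) else 0) (e j)"

definition row :: "(nat \<Rightarrow> (complex ^ 'd) cfun) \<Rightarrow> (complex ^ 'd) cfun" where
  "row v = (\<Sum>j<n. cscale (sqrt (b (length (e j)))) (ball_monom (e j) * v j))"

lemma b_e: "j < n \<Longrightarrow> 0 \<le> b (length (e j))"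
  using bij b_words_nonneg[of "e j" N] by (auto simp: bij_betw_def)

lemma row_bounded:
  assumes v: "\<And>j. j < n \<Longrightarrow> v j \<in> H"
  shows row_mem: "row v \<in> H" and nrm_row_le: "nrm (row v) \<le> sqrt (\<Sum>j<n. (nrm (v j))\<^sup>2)"
proof -
  \<comment> \<open>The tuple is reindexed by words through the inverse of \<open>e\<close>, so that
    \<open>row_contraction\<close> applies.\<close>
  define h where "h = (\<lambda>p. v (the_inv_into {..<n} e p))"
  have he: "h (e j) = v j" if "j < n" for j
    using bij that by (simp add: h_def bij_betw_def the_inv_into_f_f)
  have hH: "h p \<in> H" if p: "p \<in> words N" for p
  proof -
    obtain j where "j < n" "p = e j" using bij p by (auto simp: bij_betw_def)
    then show ?thesis using he v by simp
  qed
  have "row v = (\<Sum>p\<in>words N. cscale (sqrt (b (length p))) (ball_monom p * h p))"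
    unfolding row_def sum.reindex_bij_betw[OF bij, symmetric] by (rule sum.cong) (auto simp: he)
  moreover have "(\<Sum>p\<in>words N. (nrm (h p))\<^sup>2) = (\<Sum>j<n. (nrm (v j))\<^sup>2)"
    unfolding sum.reindex_bij_betw[OF bij, symmetric] by (rule sum.cong) (auto simp: he)
  ultimately show "row v \<in> H" "nrm (row v) \<le> sqrt (\<Sum>j<n. (nrm (v j))\<^sup>2)"
    using row_contraction[OF order_refl, of N h, OF hH] by auto
qed

lemma row_matrix_value:
  assumes v: "\<And>j. j < n \<Longrightarrow> v j \<in> Q"
  shows "sqrt (\<Sum>i<n. (nrm (\<Sum>j<n. row_matrix i j (v j)))\<^sup>2) = nrm (proj (row v))"
proof -
  have "(\<Sum>j<n. row_matrix 0 j (v j)) = (\<Sum>j<n. proj (cscale (sqrt (b (length (e j)))) (ball_monom (e j) * v j)))"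
    using v by (intro sum.cong) (auto simp: row_matrix_def Z_apply proj_scale quotient_subset)
  also have "\<dots> = proj (row v)"
    unfolding row_def using v by (intro proj_sum[symmetric]) (auto simp: quotient_subset)
  finally have 0: "(\<Sum>j<n. row_matrix 0 j (v j)) = proj (row v)" .
  have "(\<Sum>j<n. row_matrix i j (v j)) = 0" if "i \<noteq> 0" for i
    using that v by (intro sum.neutral) (auto simp: row_matrix_def Z_apply)
  then have "(\<Sum>i<n. (nrm (\<Sum>j<n. row_matrix i j (v j)))\<^sup>2) = (\<Sum>i<n. if i = 0 then (nrm (proj (row v)))\<^sup>2 else 0)"
    by (intro sum.cong) (auto simp: 0)
  then show ?thesis
    using n v by (simp add: row_mem quotient_subset proj_mem)
qed

abbreviation unit_tuples where
  "unit_tuples \<equiv> {v. (\<forall>j<n. v j \<in> Q) \<and> (\<Sum>j<n. (nrm (v j))\<^sup>2) \<le> 1}"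

lemma row_matrix_norm_alt: "op_matrix_norm Q ip n row_matrix = (SUP v\<in>unit_tuples. nrm (proj (row v)))"
  unfolding op_matrix_norm_def by (intro arg_cong[of _ _ Sup] image_cong) (auto simp: row_matrix_value)

lemma nrm_proj_row_le: "v \<in> unit_tuples \<Longrightarrow> nrm (proj (row v)) \<le> 1"
proof -
  assume v: "v \<in> unit_tuples"
  then have vH: "v j \<in> H" if "j < n" for j using that by (simp add: quotient_subset)
  have "nrm (proj (row v)) \<le> nrm (row v)" by (rule nrm_proj_le[OF row_mem[OF vH]])
  also have "\<dots> \<le> sqrt (\<Sum>j<n. (nrm (v j))\<^sup>2)" by (rule nrm_row_le[OF vH])
  also have "\<dots> \<le> 1" using v by simp
  finally show ?thesis .
qed

lemma row_matrix_norm_le_1: "op_matrix_norm Q ip n row_matrix \<le> 1"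
proof -
  have "(\<lambda>_. 0) \<in> unit_tuples" by (simp add: cfun.subspace_0[OF quotient_subspace])
  then have "unit_tuples \<noteq> {}" by (metis empty_iff)
  then show ?thesis unfolding row_matrix_norm_alt by (rule cSUP_least) (rule nrm_proj_row_le)
qed

text \<open>The test tuple is the adjoint of the row at \<open>f\<close>; it lies in
  \<open>Q\<close> by co-invariance. It is not normalised, so the square of \<open>row_norm\<close>
  appears, which suffices because values close to 1 have squares close to 1.\<close>

lemma row_matrix_norm_ge:
  assumes f: "f \<in> Q" and f1: "nrm f = 1"
  shows "(row_norm N f)\<^sup>2 \<le> op_matrix_norm Q ip n row_matrix"
proof -
  have fH: "f \<in> H" using f by (rule quotient_subset)
  define v where "v = (\<lambda>j. cscale (sqrt (b (length (e j)))) (adj (e j) f))"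
  have vQ: "v j \<in> Q" for j
    unfolding v_def using f by (intro cfun.subspace_scale[OF quotient_subspace] adj_mem_quotient)
  have vH: "v j \<in> H" for j by (rule quotient_subset[OF vQ])
  have "(\<Sum>j<n. (nrm (v j))\<^sup>2) = (\<Sum>j<n. b (length (e j)) * (nrm (adj (e j) f))\<^sup>2)"
    using fH by (intro sum.cong) (auto simp: v_def adj_mem power_mult_distrib b_e)
  also have "\<dots> = (row_norm N f)\<^sup>2"
    unfolding row_norm_sq by (rule sum.reindex_bij_betw[OF bij])
  also have "\<dots> \<le> 1"
    using row_norm_le[OF fH, of N] row_norm_nonneg[of N f] f1 by (simp add: power_le_one)
  finally have v: "v \<in> unit_tuples" using vQ by simp
  have "row v = (\<Sum>p\<in>words N. cscale (sqrt (b (length p))) (ball_monom p * cscale (sqrt (b (length p))) (adj p f)))"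
    unfolding row_def v_def by (rule sum.reindex_bij_betw[OF bij])
  then have "ip (row v) f = complex_of_real ((row_norm N f)\<^sup>2)"
    using row_test_vector[OF fH] by simp
  then have "ip (proj (row v)) f = complex_of_real ((row_norm N f)\<^sup>2)"
    using ip_proj[OF row_mem[of v, OF vH] f] by simp
  moreover have "cmod (ip (proj (row v)) f) \<le> nrm (proj (row v)) * nrm f"
    using proj_mem[OF row_mem[of v, OF vH]] fH by (intro cauchy_schwarz) (auto simp: quotient_subset)
  ultimately have "(row_norm N f)\<^sup>2 \<le> nrm (proj (row v))" using f1 by (simp add: norm_power)
  also have "\<dots> \<le> op_matrix_norm Q ip n row_matrix"
    unfolding row_matrix_norm_alt using v nrm_proj_row_le by (intro cSUP_upper bdd_aboveI2[of _ _ 1]) auto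
  finally show ?thesis .
qed

lemma row_matrix_mem: "row_matrix i j \<in> quotient_algebra H ip \<aa>"
  by (simp add: row_matrix_def Z_mem)

text \<open>The character sends each entry to its weight times a monomial at one point, and summing
  over words collapses the monomials into powers of the squared length of that point.\<close>

lemma character_row_norm:
  assumes \<tau>: "\<tau> \<in> characters (quotient_algebra H ip \<aa>)"
  shows "scalar_matrix_norm n (\<lambda>i j. gelfand_transform (quotient_algebra H ip \<aa>) (row_matrix i j) \<tau>)
    = sqrt (\<Sum>m=1..N. b m * (\<Sum>i\<in>UNIV. (cmod (\<tau> (Z 1 [i])))\<^sup>2) ^ m)"
proof -
  define l where "l = (\<chi> i. \<tau> (Z 1 [i]))"
  define t where "t = (\<Sum>i\<in>UNIV. (cmod (\<tau> (Z 1 [i])))\<^sup>2)"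
  have ll: "cinner l l = complex_of_real t"
    by (simp add: cinner_def l_def t_def complex_norm_square flip: of_real_power)
  have entry: "gelfand_transform (quotient_algebra H ip \<aa>) (row_matrix i j) \<tau>
      = (if i = 0 then complex_of_real (sqrt (b (length (e j)))) * word_monom (e j) l else 0)" for i j
    using character_Z[OF \<tau>, of _ "e j", folded l_def] \<tau> by (simp add: gelfand_transform_def row_matrix_def)
  have "scalar_matrix_norm n (\<lambda>i j. gelfand_transform (quotient_algebra H ip \<aa>) (row_matrix i j) \<tau>)
      = sqrt (\<Sum>j<n. (cmod (complex_of_real (sqrt (b (length (e j)))) * word_monom (e j) l))\<^sup>2)"
    unfolding entry by (rule scalar_row_norm[OF n])
  also have "(\<Sum>j<n. (cmod (complex_of_real (sqrt (b (length (e j)))) * word_monom (e j) l))\<^sup>2)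
      = (\<Sum>j<n. b (length (e j)) * (cmod (word_monom (e j) l))\<^sup>2)"
    by (intro sum.cong) (auto simp: norm_mult power_mult_distrib b_e)
  also have "\<dots> = (\<Sum>p\<in>words N. b (length p) * (cmod (word_monom p l))\<^sup>2)"
    by (rule sum.reindex_bij_betw[OF bij])
  also have "\<dots> = (\<Sum>m=1..N. b m * t ^ m)"
  proof -
    have "complex_of_real (\<Sum>p\<in>words N. b (length p) * (cmod (word_monom p l))\<^sup>2)
        = (\<Sum>p\<in>words N. complex_of_real (b (length p)) * (word_monom p l * cnj (word_monom p l)))"
      by (simp only: of_real_sum of_real_mult complex_norm_square)
    also have "\<dots> = complex_of_real (\<Sum>m=1..N. b m * t ^ m)"
      unfolding sum_words_monom[of "\<lambda>m. of_real (b m)"] by (simp add: ll)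
    finally show ?thesis by (simp only: of_real_eq_iff)
  qed
  finally show ?thesis by (simp only: t_def)
qed

end

section \<open>Consequences of a completely isometric Gelfand transform\<close>

context cnp_ideal
begin

lemma words_enum:
  assumes "N \<ge> 1"
  obtains n e where "cnp_row H ip a b \<aa> N n e"
proof -
  obtain e where e: "bij_betw e {..<card (words N :: 'd list set)} (words N :: 'd list set)"
    using ex_bij_betw_nat_finite[OF finite_words] by (auto simp: atLeast0LessThan)
  have "[undefined] \<in> (words N :: 'd list set)" using assms by (simp add: words_def)
  then have "card (words N :: 'd list set) \<ge> 1"
    by (metis One_nat_def Suc_leI card_gt_0_iff empty_iff finite_words)
  with e have "cnp_row H ip a b \<aa> N (card (words N :: 'd list set)) e"
    by unfold_locales
  then show thesis by (rule that)
qed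

text \<open>The inequality half of complete isometry makes the scalar rows contractions for every
  \<open>N\<close>, and \<open>le_1_if_b_series_le_1\<close> then confines the point to the closed
  ball.\<close>

lemma character_norm_le_1:
  assumes iso: "gelfand_completely_isometric Q ip (quotient_algebra H ip \<aa>)"
    and \<tau>: "\<tau> \<in> characters (quotient_algebra H ip \<aa>)"
  shows "(\<Sum>i\<in>UNIV. (cmod (\<tau> (Z 1 [i])))\<^sup>2) \<le> 1" (is "?t \<le> 1")
proof (rule le_1_if_b_series_le_1)
  fix N
  show "(\<Sum>m=1..N. b m * ?t ^ m) \<le> 1"
  proof (cases "N \<ge> 1")
    case True
    then obtain n e where "cnp_row H ip a b \<aa> N n e" by (rule words_enum)
    then interpret cnp_row H ip a b \<aa> N n e .
    have "sqrt (\<Sum>m=1..N. b m * ?t ^ m) \<le> op_matrix_norm Q ip n row_matrix"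
      using iso[unfolded gelfand_completely_isometric_def, rule_format, of n row_matrix] \<tau> n row_matrix_mem
      unfolding character_row_norm[OF \<tau>, symmetric] by blast
    also have "\<dots> \<le> 1" by (rule row_matrix_norm_le_1)
    finally show ?thesis by simp
  qed simp
qed (simp add: sum_nonneg)

text \<open>The attainment half: some character realises the norm of the row, and its point has
  length at most 1, so that norm is at most \<open>sqrt B\<close>.\<close>

lemma row_norm_le_if_isometric:
  assumes iso: "gelfand_completely_isometric Q ip (quotient_algebra H ip \<aa>)"
    and B: "\<And>N. (\<Sum>m=1..N. b m) \<le> B" "0 \<le> B"
    and f: "f \<in> Q" "nrm f = 1"
  shows "(row_norm N f)\<^sup>2 \<le> sqrt B"
proof (cases "N \<ge> 1")
  case True
  then obtain n e where "cnp_row H ip a b \<aa> N n e" by (rule words_enum)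
  then interpret cnp_row H ip a b \<aa> N n e .
  obtain \<tau> where \<tau>: "\<tau> \<in> characters (quotient_algebra H ip \<aa>)"
    and eq: "op_matrix_norm Q ip n row_matrix =
      scalar_matrix_norm n (\<lambda>i j. gelfand_transform (quotient_algebra H ip \<aa>) (row_matrix i j) \<tau>)"
    using iso[unfolded gelfand_completely_isometric_def, rule_format, of n row_matrix] n row_matrix_mem by blast
  let ?t = "\<Sum>i\<in>UNIV. (cmod (\<tau> (Z 1 [i])))\<^sup>2"
  have "(row_norm N f)\<^sup>2 \<le> op_matrix_norm Q ip n row_matrix"
    by (rule row_matrix_norm_ge[OF f])
  also have "\<dots> = sqrt (\<Sum>m=1..N. b m * ?t ^ m)"
    unfolding eq by (rule character_row_norm[OF \<tau>])
  also have "(\<Sum>m=1..N. b m * ?t ^ m) \<le> (\<Sum>m=1..N. b m * 1)"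
    using character_norm_le_1[OF iso \<tau>] b_nonneg
    by (intro sum_mono mult_left_mono power_le_one) (auto simp: sum_nonneg)
  also have "\<dots> \<le> B" using B(1)[of N] by simp
  finally show ?thesis by simp
next
  case False
  then have "N = 0" by simp
  then have "words N = ({} :: 'd list set)" by (auto simp: words_def)
  then show ?thesis using B by (simp add: row_norm_def)
qed

text \<open>Evaluation at the origin is a linear functional, so it has a nonzero kernel vector in
  the span of two independent ones.\<close>

lemma exists_unit_vanishing_at_0:
  assumes S: "S \<subseteq> Q" "cfun.independent S" "card S = 2"
  obtains f where "f \<in> Q" "f 0 = 0" "nrm f = 1"
proof -
  obtain s t where st: "S = {s, t}" "s \<noteq> t" using S(3) by (auto simp: card_2_iff)
  have Q: "s \<in> Q" "t \<in> Q" using S(1) st by auto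
  have "\<exists>g\<in>Q. g 0 = 0 \<and> g \<noteq> 0"
  proof (cases "s 0 = 0")
    case True
    have "s \<noteq> 0" using S(2) st cfun.dependent_zero by blast
    with True Q show ?thesis by blast
  next
    case False
    define g where "g = t - cscale (t 0 / s 0) s"
    have "g \<in> Q" unfolding g_def
      by (intro cfun.subspace_diff[OF quotient_subspace] cfun.subspace_scale[OF quotient_subspace] Q)
    moreover have "g 0 = 0" using False by (simp add: g_def cscale_def)
    moreover have "g \<noteq> 0"
    proof
      assume "g = 0"
      then have "t = cscale (t 0 / s 0) s" by (simp add: g_def)
      then have "t \<in> cfun.span {s}"
        by (metis cfun.span_base cfun.span_scale singletonI)
      moreover have "S - {t} = {s}" using st by auto
      ultimately show False using S(2) st unfolding cfun.dependent_def by auto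
    qed
    ultimately show ?thesis by blast
  qed
  then obtain g where g: "g \<in> Q" "g 0 = 0" "g \<noteq> 0" by blast
  have gH: "g \<in> H" using g(1) by (rule quotient_subset)
  have "nrm g \<noteq> 0" using nrm_eq_0[OF gH] g(3) by blast
  with nrm_nonneg[OF gH] have pos: "nrm g > 0" by simp
  show thesis
  proof (rule that)
    show "cscale (complex_of_real (1 / nrm g)) g \<in> Q"
      by (rule cfun.subspace_scale[OF quotient_subspace g(1)])
    show "cscale (complex_of_real (1 / nrm g)) g 0 = 0" using g(2) by (simp add: cscale_def)
    show "nrm (cscale (complex_of_real (1 / nrm g)) g) = 1" using pos gH by (simp add: norm_divide)
  qed
qed

end

theorem theorem5p2:
  fixes H :: "(complex ^ 'd) cfun set"
    and ip :: "(complex ^ 'd) cfun \<Rightarrow> (complex ^ 'd) cfun \<Rightarrow> complex"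
    and a b :: "nat \<Rightarrow> real"
    and \<aa> :: "(complex ^ 'd) cfun set"
  assumes "regular_ui_cnp_space H ip a b"
    and "\<not> maximal_cnp b"
    and "weak_star_closed_ideal (ball 0 1) H ip \<aa>"
    and "\<aa> \<noteq> multipliers (ball 0 1) H"
    and "\<exists>S \<subseteq> quotient_space H ip \<aa>. cfun.independent S \<and> card S = 2"
  shows "\<not> gelfand_completely_isometric (quotient_space H ip \<aa>) ip (quotient_algebra H ip \<aa>)"
proof
  assume iso: "gelfand_completely_isometric (quotient_space H ip \<aa>) ip (quotient_algebra H ip \<aa>)"
  interpret cnp_ideal H ip a b \<aa>
    using assms(1,3) by unfold_locales
  obtain f where f: "f \<in> Q" "f 0 = 0" "nrm f = 1"
    using assms(5) exists_unit_vanishing_at_0 by metis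
  obtain B where B: "0 \<le> B" "B < 1" "\<And>N. (\<Sum>m=1..N. b m) \<le> B"
    using not_maximal_bound[OF assms(2)] by metis
  \<comment> \<open>Half of the gap between \<open>sqrt B\<close> and 1, so that
    \<open>sqrt B = 1 - 2 * r\<close>, which is smaller than \<open>(1 - r)\<^sup>2\<close> by
    \<open>r\<^sup>2\<close>.\<close>
  define r where "r = (1 - sqrt B) / 2"
  have r: "0 < r" "r \<le> 1/2" using B by (auto simp: r_def)
  obtain N where N: "row_norm N f \<ge> 1 - r"
    using row_norm_lower[OF quotient_subset[OF f(1)] f(2) r(1)] f(3) by auto
  have "sqrt B = 1 - 2 * r" by (simp add: r_def field_simps)
  also have "\<dots> < (1 - r)\<^sup>2" using r by (simp add: power2_diff)
  also have "\<dots> \<le> (row_norm N f)\<^sup>2" using N r by (intro power_mono) auto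
  also have "\<dots> \<le> sqrt B" by (rule row_norm_le_if_isometric[OF iso B(3) B(1) f(1,3)])
  finally show False by simp
qed

end
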